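(* Let $\mathcal{X}_0$ and $\mathcal{X}_{\mathrm{in}}$ be finite sets with $d_0=|\mathcal{X}_0|>1$, let $G$ be a graph on $\mathcal{X}_{\mathrm{in}}$, and let $\mathbb{K}$ be a field. For any $\mathcal{Y}\subseteq\mathcal{X}_{\mathrm{in}}$ the set $V_{G,\mathcal{Y}}$ is the variety of the ideal $I_{G,\mathcal{Y}}\subseteq\mathfrak{R}=\mathbb{K}[p_{ix}:i\in\mathcal{X}_0,x\in\mathcal{X}_{\mathrm{in}}]$ generated by the monomials $$p_{ix}\qquad\text{for all } x\in\mathcal{X}_{\mathrm{in}}\setminus\mathcal{Y}\text{ and } i\in\mathcal{X}_0,$$ and the binomials $f^{ij}_{xy}=p_{ix}p_{jy}-p_{iy}p_{jx}$ for all $i,j\in\mathcal{X}_0$ and all $x,y\in\mathcal{Y}$ that lie in the same connected component of $G_{\mathcal{Y}}$. The ideal $I_{G,\mathcal{Y}}$ is prime, and the variety $V_{G,\mathcal{Y}}$ is rational.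
   Context: Graphs are finite, undirected, and edges join distinct vertices; "a graph on $\mathcal{X}_{\mathrm{in}}$" has vertex set $\mathcal{X}_{\mathrm{in}}$. For $\mathcal{Y}\subseteq\mathcal{X}_{\mathrm{in}}$, $G_{\mathcal{Y}}$ denotes the subgraph of $G$ induced by $\mathcal{Y}$. Two vectors $v,w$ in the same $\mathbb{K}$-vector space are proportional if $v=\lambda w$ or $w=\lambda v$ for some $\lambda\in\mathbb{K}$ ($\lambda=0$ is allowed). A point $p=(p_{ix})\in\mathbb{K}^{\mathcal{X}_0\times\mathcal{X}_{\mathrm{in}}}$ is viewed as a $d_0\times|\mathcal{X}_{\mathrm{in}}|$-matrix with columns $\tilde p_x=(p_{ix})_{i\in\mathcal{X}_0}$, $x\in\mathcal{X}_{\mathrm{in}}$. $V_{G,\mathcal{Y}}$ is the set of all $p\in\mathbb{K}^{\mathcal{X}_0\times\mathcal{X}_{\mathrm{in}}}$ such that $\tilde p_x=0$ for all $x\in\mathcal{X}_{\mathrm{in}}\setminus\mathcal{Y}$, and such that $\tilde p_x$ and $\tilde p_y$ are proportional whenever $x,y$ lie in the same connected component of $G_{\mathcal{Y}}$. The variety of an ideal of $\mathfrak{R}$ is its set of zeros in $\mathbb{K}^{\mathcal{X}_0\times\mathcal{X}_{\mathrm{in}}}$. "The variety $V_{G,\mathcal{Y}}$ is rational" means that the variety over $\mathbb{K}$ defined by the prime ideal $I_{G,\mathcal{Y}}$ is rational over $\mathbb{K}$, i.e. the fraction field of $\mathfrak{R}/I_{G,\mathcal{Y}}$ is a purely transcendental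 extension of $\mathbb{K}$. *)

theory Defs
  imports
    "HOL-Library.Poly_Mapping"
    "HOL-Algebra.Algebra"
    "HOL-Algebra.Algebraic_Closure_Type"
    "Graph_Theory.Digraph_Component"
begin

section \<open>Polynomial rings in a set of variables\<close>

text \<open>
  A polynomial over \<open>'k\<close> in variables of type \<open>'v\<close> maps monomials (exponent vectors
  of finite support) to coefficients, with finite support.
\<close>

type_synonym ('v, 'k) mpoly = "('v \<Rightarrow>\<^sub>0 nat) \<Rightarrow>\<^sub>0 'k"

definition mpoly_ring :: "'v set \<Rightarrow> ('v, 'k::field) mpoly ring" where
  "mpoly_ring V = ring_of_type_algebra
     \<lparr>carrier := {P. \<forall>m \<in> Poly_Mapping.keys P. Poly_Mapping.keys m \<subseteq> V}\<rparr>"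

definition Const :: "'k \<Rightarrow> ('v, 'k::field) mpoly" where
  "Const c = Poly_Mapping.single 0 c"

definition Var :: "'v \<Rightarrow> ('v, 'k::field) mpoly" where
  "Var v = Poly_Mapping.single (Poly_Mapping.single v 1) 1"

text \<open>
  Value of a polynomial at \<open>a\<close> in a ring \<open>L\<close> that receives the coefficients through \<open>\<phi>\<close>.
\<close>

definition mpoly_eval ::
    "('l, 'm) ring_scheme \<Rightarrow> ('k \<Rightarrow> 'l) \<Rightarrow> ('v \<Rightarrow> 'l) \<Rightarrow> ('v, 'k::field) mpoly \<Rightarrow> 'l" where
  "mpoly_eval L \<phi> a P =
     (\<Oplus>\<^bsub>L\<^esub>m \<in> Poly_Mapping.keys P. \<phi> (Poly_Mapping.lookup P m) \<otimes>\<^bsub>L\<^esub>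
        (\<Otimes>\<^bsub>L\<^esub>v \<in> Poly_Mapping.keys m. a v [^]\<^bsub>L\<^esub> Poly_Mapping.lookup m v))"

text \<open>
  Points of affine space with coordinates indexed by \<open>V\<close> are functions on \<open>V\<close>,
  made \<open>undefined\<close> elsewhere.
\<close>

definition zero_set :: "'v set \<Rightarrow> ('v, 'k::field) mpoly set \<Rightarrow> ('v \<Rightarrow> 'k) set" where
  "zero_set V J = {p \<in> V \<rightarrow>\<^sub>E UNIV. \<forall>P \<in> J. mpoly_eval ring_of_type_algebra id p P = 0}"


section \<open>Fraction fields and rationality\<close>

definition frac_rel :: "('a, 'b) ring_scheme \<Rightarrow> (('a \<times> 'a) \<times> ('a \<times> 'a)) set" where
  "frac_rel D = {((a, b), (c, d)).
     a \<in> carrier D \<and> b \<in> carrier D - {\<zero>\<^bsub>D\<^esub>} \<and> c \<in> carrier D \<and> d \<in> carrier D - {\<zero>\<^bsub>D\<^esub>} \<and>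
     a \<otimes>\<^bsub>D\<^esub> d = c \<otimes>\<^bsub>D\<^esub> b}"

definition fraction :: "('a, 'b) ring_scheme \<Rightarrow> 'a \<Rightarrow> 'a \<Rightarrow> ('a \<times> 'a) set" where
  "fraction D a b = frac_rel D `` {(a, b)}"

definition fraction_field :: "('a, 'b) ring_scheme \<Rightarrow> ('a \<times> 'a) set ring" where
  "fraction_field D =
     \<lparr>carrier = (carrier D \<times> (carrier D - {\<zero>\<^bsub>D\<^esub>})) // frac_rel D,
      monoid.mult = (\<lambda>S T. \<Union>(a, b) \<in> S. \<Union>(c, d) \<in> T. fraction D (a \<otimes>\<^bsub>D\<^esub> c) (b \<otimes>\<^bsub>D\<^esub> d)),
      one = fraction D \<one>\<^bsub>D\<^esub> \<one>\<^bsub>D\<^esub>,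
      ring.zero = fraction D \<zero>\<^bsub>D\<^esub> \<one>\<^bsub>D\<^esub>,
      add = (\<lambda>S T. \<Union>(a, b) \<in> S. \<Union>(c, d) \<in> T.
               fraction D (a \<otimes>\<^bsub>D\<^esub> d \<oplus>\<^bsub>D\<^esub> c \<otimes>\<^bsub>D\<^esub> b) (b \<otimes>\<^bsub>D\<^esub> d))\<rparr>"

definition algebraically_independent ::
    "('k::field \<Rightarrow> 'l) \<Rightarrow> ('l, 'm) ring_scheme \<Rightarrow> 'l set \<Rightarrow> bool" where
  "algebraically_independent \<phi> L B \<longleftrightarrow>
     (\<forall>P \<in> carrier (mpoly_ring B). mpoly_eval L \<phi> id P = \<zero>\<^bsub>L\<^esub> \<longrightarrow> P = 0)"

text \<open>The field \<open>L\<close> is regarded as an extension of \<open>'k\<close> through the embedding \<open>\<phi>\<close>.\<close>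

definition purely_transcendental ::
    "('k::field \<Rightarrow> 'l) \<Rightarrow> ('l, 'm) ring_scheme \<Rightarrow> bool" where
  "purely_transcendental \<phi> L \<longleftrightarrow>
     field L \<and> \<phi> \<in> ring_hom ring_of_type_algebra L \<and>
     (\<exists>B \<subseteq> carrier L. algebraically_independent \<phi> L B \<and>
        generate_field L (range \<phi> \<union> B) = carrier L)"

text \<open>
  Rationality over \<open>'k\<close> of the variety defined by a prime ideal \<open>J\<close> of the polynomial
  ring in the variables \<open>V\<close>.
\<close>

definition rational_variety :: "'v set \<Rightarrow> ('v, 'k::field) mpoly set \<Rightarrow> bool" where
  "rational_variety V J \<longleftrightarrow>
     (let D = mpoly_ring V Quot J
      in purely_transcendental
           (\<lambda>c. fraction D (J +>\<^bsub>mpoly_ring V\<^esub> Const c) \<one>\<^bsub>D\<^esub>) (fraction_field D))"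


section \<open>The variety and the ideal of a graph\<close>

text \<open>
  An undirected graph is a symmetric digraph, so its connected components are the
  strongly connected ones.
\<close>

definition same_component :: "('x, 'e) pre_digraph \<Rightarrow> 'x \<Rightarrow> 'x \<Rightarrow> bool" where
  "same_component H x y \<longleftrightarrow> (\<exists>C \<in> pre_digraph.sccs_verts H. x \<in> C \<and> y \<in> C)"

text \<open>Proportionality in the vector space of functions from \<open>S\<close> to \<open>'k\<close>.\<close>

definition proportional :: "'i set \<Rightarrow> ('i \<Rightarrow> 'k::field) \<Rightarrow> ('i \<Rightarrow> 'k) \<Rightarrow> bool" where
  "proportional S v w \<longleftrightarrow>
     (\<exists>c. (\<forall>i \<in> S. v i = c * w i) \<or> (\<forall>i \<in> S. w i = c * v i))"

definition column :: "('i \<times> 'x \<Rightarrow> 'k) \<Rightarrow> 'x \<Rightarrow> 'i \<Rightarrow> 'k" where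
  "column p x = (\<lambda>i. p (i, x))"

definition graph_variety ::
    "'i set \<Rightarrow> 'x set \<Rightarrow> ('x, 'e) pre_digraph \<Rightarrow> 'x set \<Rightarrow> ('i \<times> 'x \<Rightarrow> 'k::field) set" where
  "graph_variety X0 Xin G Y =
     {p \<in> X0 \<times> Xin \<rightarrow>\<^sub>E UNIV.
        (\<forall>x \<in> Xin - Y. \<forall>i \<in> X0. column p x i = 0) \<and>
        (\<forall>x \<in> Y. \<forall>y \<in> Y. same_component (G \<restriction> Y) x y \<longrightarrow>
           proportional X0 (column p x) (column p y))}"

definition graph_ideal ::
    "'i set \<Rightarrow> 'x set \<Rightarrow> ('x, 'e) pre_digraph \<Rightarrow> 'x set \<Rightarrow> ('i \<times> 'x, 'k::field) mpoly set" where
  "graph_ideal X0 Xin G Y = Idl\<^bsub>mpoly_ring (X0 \<times> Xin)\<^esub>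
     ({Var (i, x) | i x. i \<in> X0 \<and> x \<in> Xin - Y} \<union>
      {Var (i, x) * Var (j, y) - Var (i, y) * Var (j, x) | i j x y.
         i \<in> X0 \<and> j \<in> X0 \<and> x \<in> Y \<and> y \<in> Y \<and> same_component (G \<restriction> Y) x y})"

end

theory Submission
  imports Defs
begin

text \<open>
  A matrix whose columns in one class are pairwise proportional is, class by class, a matrix of
  rank at most 1. Its generic form is the Segre parametrization
  \<open>p (i, x) = a (i, class of x) * t x\<close>, with \<open>p (i, x) = 0\<close> for \<open>x\<close> outside \<open>Y\<close>. All assertions come from
  this substitution, viewed as a homomorphism \<open>segre\<close> from the polynomial ring in the entries to
  the polynomial ring in the parameters.

  The ideal is prime because it is the kernel of \<open>segre\<close>, whose target is an integral domain
  (\<open>minors_ideal_eq_kernel\<close>). The substitution sends monomials to monomials or to 0, so its kernel is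
  spanned by the monomials that go to 0 and by differences of monomials with equal image
  (\<open>kernel_monomial_subst_subset\<close>). Two monomials supported on the columns in \<open>Y\<close> have the same
  image exactly if, as matrices of exponents, they have the same column sums and the same row
  sums within each class. Such matrices are connected by exchanges of \<open>(i, y), (j, x)\<close> for
  \<open>(i, x), (j, y)\<close>, and the two monomials of an exchange differ by a multiple of a generator
  (\<open>binomial_in_minors_ideal\<close>).

  For rationality, fix a row \<open>i0\<close> and take the coordinates in this row together with the columns of
  one representative in each class. They are independent modulo the ideal, because \<open>segre\<close> is
  injective on polynomials in them (\<open>inj_on_segre_cross\<close>), and a minor expresses every other
  coordinate as a quotient of them; \<open>rational_varietyI\<close> turns this into a statement on the
  function field.

  The description of the points of the variety is elementary: the zeros of an ideal are the common
  zeros of its generators (\<open>zero_set_genideal\<close>), and the 2-by-2 minors of two columns vanish exactly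
  if the columns are proportional (\<open>proportional_iff_minors\<close>).
\<close>

section \<open>The ring of polynomials in a set of variables\<close>

lemma ring_of_type_algebra_simps [simp]:
  "carrier ring_of_type_algebra = UNIV"
  "x \<otimes>\<^bsub>ring_of_type_algebra\<^esub> y = x * y"
  "\<one>\<^bsub>ring_of_type_algebra\<^esub> = 1"
  "\<zero>\<^bsub>ring_of_type_algebra\<^esub> = 0"
  "x \<oplus>\<^bsub>ring_of_type_algebra\<^esub> y = x + y"
  by (auto simp: ring_of_type_algebra_def)

lemma carrier_mpoly_ring:
  "P \<in> carrier (mpoly_ring V) \<longleftrightarrow> (\<forall>m\<in>Poly_Mapping.keys P. Poly_Mapping.keys m \<subseteq> V)"
  by (simp add: mpoly_ring_def)

lemma mpoly_ring_simps [simp]: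
  "x \<otimes>\<^bsub>mpoly_ring V\<^esub> y = x * y"
  "\<one>\<^bsub>mpoly_ring V\<^esub> = 1"
  "\<zero>\<^bsub>mpoly_ring V\<^esub> = 0"
  "x \<oplus>\<^bsub>mpoly_ring V\<^esub> y = x + y"
  by (auto simp: mpoly_ring_def)

lemma mpoly_zero_closed: "0 \<in> carrier (mpoly_ring V)"
  by (simp add: carrier_mpoly_ring)

lemma mpoly_single_closed:
  "Poly_Mapping.keys m \<subseteq> V \<Longrightarrow> Poly_Mapping.single m c \<in> carrier (mpoly_ring V)"
  by (simp add: carrier_mpoly_ring)

lemma mpoly_one_closed: "1 \<in> carrier (mpoly_ring V)"
  using mpoly_single_closed[of 0 V 1] by simp

lemma mpoly_Const_closed: "Const c \<in> carrier (mpoly_ring V)"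
  by (simp add: Const_def mpoly_single_closed)

lemma mpoly_Var_closed: "v \<in> V \<Longrightarrow> Var v \<in> carrier (mpoly_ring V)"
  by (simp add: Var_def mpoly_single_closed)

lemma mpoly_add_closed:
  assumes "P \<in> carrier (mpoly_ring V)" "Q \<in> carrier (mpoly_ring V)"
  shows "P + Q \<in> carrier (mpoly_ring V)"
  using assms keys_add[of P Q] unfolding carrier_mpoly_ring by blast

lemma mpoly_uminus_closed: "P \<in> carrier (mpoly_ring V) \<Longrightarrow> - P \<in> carrier (mpoly_ring V)"
  unfolding carrier_mpoly_ring by (simp add: in_keys_iff lookup_uminus)

lemma mpoly_diff_closed:
  assumes "P \<in> carrier (mpoly_ring V)" "Q \<in> carrier (mpoly_ring V)"
  shows "P - Q \<in> carrier (mpoly_ring V)"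
  using mpoly_add_closed[OF assms(1) mpoly_uminus_closed[OF assms(2)]] by simp

lemma mpoly_mult_closed:
  assumes "P \<in> carrier (mpoly_ring V)" "Q \<in> carrier (mpoly_ring V)"
  shows "P * Q \<in> carrier (mpoly_ring V)"
  unfolding carrier_mpoly_ring
proof
  fix m assume "m \<in> Poly_Mapping.keys (P * Q)"
  then obtain a b where "a \<in> Poly_Mapping.keys P" "b \<in> Poly_Mapping.keys Q" "m = a + b"
    using keys_mult[of P Q] by blast
  with assms keys_add[of a b] show "Poly_Mapping.keys m \<subseteq> V"
    unfolding carrier_mpoly_ring by blast
qed

lemmas mpoly_closed = mpoly_zero_closed mpoly_one_closed mpoly_Const_closed mpoly_Var_closed
  mpoly_add_closed mpoly_uminus_closed mpoly_diff_closed mpoly_mult_closed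

lemma cring_mpoly_ring: "cring (mpoly_ring V :: ('v, 'k::field) mpoly ring)"
proof (rule cringI)
  show "abelian_group (mpoly_ring V :: ('v, 'k) mpoly ring)"
    by (rule abelian_groupI)
      (auto simp: mpoly_closed algebra_simps intro: bexI[of _ "- x" for x])
  show "comm_monoid (mpoly_ring V :: ('v, 'k) mpoly ring)"
    by (rule comm_monoidI) (auto simp: mpoly_closed algebra_simps)
qed (auto simp: mpoly_closed algebra_simps)

lemma ring_mpoly_ring: "ring (mpoly_ring V :: ('v, 'k::field) mpoly ring)"
  by (rule cring.axioms(1)[OF cring_mpoly_ring])

lemma mpoly_ring_minus:
  fixes P Q :: "('v, 'k::field) mpoly"
  assumes "P \<in> carrier (mpoly_ring V)" "Q \<in> carrier (mpoly_ring V)"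
  shows "P \<ominus>\<^bsub>mpoly_ring V\<^esub> Q = P - Q"
proof -
  interpret cring "mpoly_ring V :: ('v, 'k) mpoly ring" by (rule cring_mpoly_ring)
  have "\<ominus>\<^bsub>mpoly_ring V\<^esub> Q = - Q"
    by (rule minus_equality) (use assms in \<open>auto simp: mpoly_closed\<close>)
  then show ?thesis by (simp add: minus_eq)
qed

lemma poly_mapping_eq_sum_single:
  "(\<Sum>m\<in>Poly_Mapping.keys P. Poly_Mapping.single m (Poly_Mapping.lookup P m)) = P"
proof (rule poly_mapping_eqI)
  fix k
  have "(\<Sum>m\<in>Poly_Mapping.keys P. Poly_Mapping.lookup P m when m = k) = Poly_Mapping.lookup P k"
    by (cases "k \<in> Poly_Mapping.keys P") (auto simp: when_def in_keys_iff)
  then show "Poly_Mapping.lookup (\<Sum>m\<in>Poly_Mapping.keys P.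
      Poly_Mapping.single m (Poly_Mapping.lookup P m)) k = Poly_Mapping.lookup P k"
    by (simp add: lookup_sum lookup_single)
qed

text \<open>
  Induction on the number of terms. It stays inside the ring of polynomials in the variables
  \<open>V\<close>, because only there is an evaluation at a point given on \<open>V\<close> meaningful.
\<close>

lemma mpoly_ring_induct [consumes 1, case_names zero monomial add]:
  assumes P: "P \<in> carrier (mpoly_ring V)"
    and "Q 0"
    and "\<And>m c. Poly_Mapping.keys m \<subseteq> V \<Longrightarrow> Q (Poly_Mapping.single m c)"
    and "\<And>A B. A \<in> carrier (mpoly_ring V) \<Longrightarrow> B \<in> carrier (mpoly_ring V) \<Longrightarrow>
           Q A \<Longrightarrow> Q B \<Longrightarrow> Q (A + B)"
  shows "Q P"
proof -
  have "(\<Sum>m\<in>S. Poly_Mapping.single m (Poly_Mapping.lookup P m)) \<in> carrier (mpoly_ring V)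
      \<and> Q (\<Sum>m\<in>S. Poly_Mapping.single m (Poly_Mapping.lookup P m))"
    if "finite S" "S \<subseteq> Poly_Mapping.keys P" for S
    using that
  proof (induction S rule: finite_induct)
    case (insert m S)
    moreover have "Poly_Mapping.keys m \<subseteq> V"
      using insert P by (simp add: carrier_mpoly_ring)
    ultimately show ?case
      using assms by (simp add: mpoly_add_closed mpoly_single_closed)
  qed (use assms in \<open>simp_all add: mpoly_zero_closed\<close>)
  from this[of "Poly_Mapping.keys P"] show ?thesis
    by (simp add: poly_mapping_eq_sum_single)
qed

lemma monomial_extract:
  fixes m :: "'v \<Rightarrow>\<^sub>0 nat"
  assumes "v \<in> Poly_Mapping.keys m"
  obtains n where "m = Poly_Mapping.single v 1 + n" "Poly_Mapping.keys n \<subseteq> Poly_Mapping.keys m"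
proof
  show m: "m = Poly_Mapping.single v 1 + (m - Poly_Mapping.single v 1)"
    by (rule poly_mapping_eqI)
      (use assms in \<open>auto simp: lookup_add lookup_minus lookup_single when_def in_keys_iff\<close>)
  show "Poly_Mapping.keys (m - Poly_Mapping.single v 1) \<subseteq> Poly_Mapping.keys m"
    by (auto simp: lookup_minus in_keys_iff)
qed

lemma keys_single_add:
  fixes m :: "'v \<Rightarrow>\<^sub>0 nat"
  shows "Poly_Mapping.keys (Poly_Mapping.single v 1 + m) = insert v (Poly_Mapping.keys m)"
  by (auto simp: in_keys_iff lookup_add lookup_single when_def split: if_splits)

lemma Var_mult_single:
  "Var v * Poly_Mapping.single m c = Poly_Mapping.single (Poly_Mapping.single v 1 + m) c"
  by (simp add: Var_def mult_single)

lemma monomial_induct [consumes 1, case_names zero add_single]: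
  fixes m :: "'v \<Rightarrow>\<^sub>0 nat"
  assumes "Poly_Mapping.keys m \<subseteq> V"
    and "Q 0"
    and "\<And>m v. Poly_Mapping.keys m \<subseteq> V \<Longrightarrow> v \<in> V \<Longrightarrow> Q m \<Longrightarrow> Q (Poly_Mapping.single v 1 + m)"
  shows "Q m"
  using assms(1)
proof (induction "\<Sum>v\<in>Poly_Mapping.keys m. Poly_Mapping.lookup m v" arbitrary: m rule: less_induct)
  case less
  show ?case
  proof (cases "m = 0")
    case False
    then obtain v where v: "v \<in> Poly_Mapping.keys m" by fastforce
    then obtain n where m: "m = Poly_Mapping.single v 1 + n"
        and sub: "Poly_Mapping.keys n \<subseteq> Poly_Mapping.keys m"
      by (rule monomial_extract)
    have "(\<Sum>v\<in>Poly_Mapping.keys n. Poly_Mapping.lookup n v)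
        = (\<Sum>v\<in>Poly_Mapping.keys m. Poly_Mapping.lookup n v)"
      by (rule sum.mono_neutral_left) (use sub in \<open>auto simp: in_keys_iff\<close>)
    also have "\<dots> < (\<Sum>v\<in>Poly_Mapping.keys m. Poly_Mapping.lookup m v)"
      by (rule sum_strict_mono_ex1) (use v in \<open>auto simp: m lookup_add intro!: bexI[of _ v]\<close>)
    finally have "Q n"
      using less sub by (meson order_trans)
    then show ?thesis
      using assms(3)[of n v] sub v less.prems m by (metis order_trans subsetD)
  qed (use assms in simp)
qed

lemma mpoly_ring_induct_generators [consumes 1, case_names Const Var add mult]:
  assumes P: "P \<in> carrier (mpoly_ring V)"
    and Const: "\<And>c. Q (Const c)" and Var: "\<And>v. v \<in> V \<Longrightarrow> Q (Var v)"
    and add: "\<And>A B. A \<in> carrier (mpoly_ring V) \<Longrightarrow> B \<in> carrier (mpoly_ring V) \<Longrightarrow>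
           Q A \<Longrightarrow> Q B \<Longrightarrow> Q (A + B)"
    and mult: "\<And>A B. A \<in> carrier (mpoly_ring V) \<Longrightarrow> B \<in> carrier (mpoly_ring V) \<Longrightarrow>
           Q A \<Longrightarrow> Q B \<Longrightarrow> Q (A * B)"
  shows "Q P"
  using P
proof (induction P rule: mpoly_ring_induct)
  case zero
  show ?case using Const[of 0] by (simp add: Const_def)
next
  case (monomial m c)
  then show ?case
  proof (induction m rule: monomial_induct)
    case zero
    show ?case using Const[of c] by (simp add: Const_def)
  next
    case (add_single m v)
    then show ?case
      unfolding Var_mult_single[symmetric]
      by (simp add: mult Var mpoly_Var_closed mpoly_single_closed)
  qed
qed (rule add)

section \<open>Evaluation of polynomials\<close>

text \<open>
  The three uses of an evaluation below differ in the target only: the ground field for points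
  of the variety, another polynomial ring for substitutions, and a fraction field for algebraic
  independence. Hence the target is a carrier-based ring, the coefficients enter it through a
  homomorphism \<open>\<phi>\<close>, and the point is constrained on \<open>V\<close> alone.
\<close>

locale evaluation = cring L for L :: "('l, 'm) ring_scheme" (structure) +
  fixes \<phi> :: "'k::field \<Rightarrow> 'l" and a :: "'v \<Rightarrow> 'l" and V :: "'v set"
  assumes coeff_hom: "\<phi> \<in> ring_hom ring_of_type_algebra L"
    and point_closed: "v \<in> V \<Longrightarrow> a v \<in> carrier L"
begin

definition mon :: "('v \<Rightarrow>\<^sub>0 nat) \<Rightarrow> 'l" where
  "mon m = (\<Otimes>v \<in> Poly_Mapping.keys m. a v [^] Poly_Mapping.lookup m v)"

lemma coeff_closed [simp]: "\<phi> c \<in> carrier L"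
  using coeff_hom by (auto simp: ring_hom_def)

lemma coeff_mult: "\<phi> (c * d) = \<phi> c \<otimes> \<phi> d"
  and coeff_add: "\<phi> (c + d) = \<phi> c \<oplus> \<phi> d"
  and coeff_one [simp]: "\<phi> 1 = \<one>"
  using coeff_hom by (auto simp: ring_hom_def)

lemma coeff_zero [simp]: "\<phi> 0 = \<zero>"
  using coeff_add[of 0 0] by (metis add.r_cancel_one coeff_closed add_0)

text \<open>
  Enlarging the index set to a common superset is harmless, since a variable of exponent 0
  contributes the factor 1. This is how monomials of different supports are compared.
\<close>

lemma mon_superset:
  assumes "finite S" "Poly_Mapping.keys m \<subseteq> S" "S \<subseteq> V"
  shows "mon m = (\<Otimes>v \<in> S. a v [^] Poly_Mapping.lookup m v)"
  unfolding mon_def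
  by (rule finprod_mono_neutral_cong_left)
    (use assms point_closed in \<open>auto simp: in_keys_iff Pi_def intro!: nat_pow_closed\<close>)

lemma mon_closed: "Poly_Mapping.keys m \<subseteq> V \<Longrightarrow> mon m \<in> carrier L"
  unfolding mon_def using point_closed by (auto intro!: finprod_closed)

lemma mon_zero [simp]: "mon 0 = \<one>"
  by (simp add: mon_def)

lemma mon_single: "v \<in> V \<Longrightarrow> mon (Poly_Mapping.single v 1) = a v"
  unfolding mon_def using point_closed[of v] by (simp add: Pi_def)

lemma mon_add:
  assumes "Poly_Mapping.keys m \<subseteq> V" "Poly_Mapping.keys n \<subseteq> V"
  shows "mon (m + n) = mon m \<otimes> mon n"
proof -
  let ?S = "Poly_Mapping.keys m \<union> Poly_Mapping.keys n"
  have "mon (m + n) = (\<Otimes>v \<in> ?S. a v [^] Poly_Mapping.lookup (m + n) v)"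
    using assms keys_add[of m n] by (intro mon_superset) auto
  also have "\<dots> = (\<Otimes>v \<in> ?S. a v [^] Poly_Mapping.lookup m v \<otimes> a v [^] Poly_Mapping.lookup n v)"
    by (rule finprod_cong')
      (use assms point_closed in \<open>auto simp: lookup_add nat_pow_mult subset_iff Pi_def\<close>)
  also have "\<dots> = (\<Otimes>v \<in> ?S. a v [^] Poly_Mapping.lookup m v)
      \<otimes> (\<Otimes>v \<in> ?S. a v [^] Poly_Mapping.lookup n v)"
    using assms point_closed by (intro finprod_multf) (auto simp: Pi_def subset_iff)
  also have "\<dots> = mon m \<otimes> mon n"
    using assms mon_superset[of ?S m] mon_superset[of ?S n] by simp
  finally show ?thesis .
qed

lemma eval_superset:
  assumes "finite S" "Poly_Mapping.keys P \<subseteq> S" "\<And>m. m \<in> S \<Longrightarrow> Poly_Mapping.keys m \<subseteq> V"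
  shows "mpoly_eval L \<phi> a P = (\<Oplus>m \<in> S. \<phi> (Poly_Mapping.lookup P m) \<otimes> mon m)"
  unfolding mpoly_eval_def mon_def[symmetric]
  by (rule add.finprod_mono_neutral_cong_left)
    (use assms mon_closed in \<open>auto simp: in_keys_iff Pi_def\<close>)

lemma eval_zero: "mpoly_eval L \<phi> a 0 = \<zero>"
  by (simp add: mpoly_eval_def)

lemma eval_single:
  assumes "Poly_Mapping.keys m \<subseteq> V"
  shows "mpoly_eval L \<phi> a (Poly_Mapping.single m c) = \<phi> c \<otimes> mon m"
  using eval_superset[of "{m}" "Poly_Mapping.single m c"] assms mon_closed by (simp add: Pi_def)

lemma eval_Const: "mpoly_eval L \<phi> a (Const c) = \<phi> c"
  by (simp add: Const_def eval_single)

lemma eval_Var: "v \<in> V \<Longrightarrow> mpoly_eval L \<phi> a (Var v) = a v"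
  using eval_single[of "Poly_Mapping.single v 1" 1] mon_single[of v] point_closed[of v]
  by (simp add: Var_def)

lemma eval_closed: "P \<in> carrier (mpoly_ring V) \<Longrightarrow> mpoly_eval L \<phi> a P \<in> carrier L"
  unfolding mpoly_eval_def mon_def[symmetric]
  using mon_closed by (intro finsum_closed) (auto simp: carrier_mpoly_ring)

lemma eval_add:
  assumes "P \<in> carrier (mpoly_ring V)" "Q \<in> carrier (mpoly_ring V)"
  shows "mpoly_eval L \<phi> a (P + Q) = mpoly_eval L \<phi> a P \<oplus> mpoly_eval L \<phi> a Q"
proof -
  let ?S = "Poly_Mapping.keys P \<union> Poly_Mapping.keys Q"
  have V: "\<And>m. m \<in> ?S \<Longrightarrow> Poly_Mapping.keys m \<subseteq> V"
    using assms by (auto simp: carrier_mpoly_ring)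
  have "mpoly_eval L \<phi> a (P + Q) = (\<Oplus>m \<in> ?S. \<phi> (Poly_Mapping.lookup (P + Q) m) \<otimes> mon m)"
    using keys_add[of P Q] V by (intro eval_superset) auto
  also have "\<dots> = (\<Oplus>m \<in> ?S. \<phi> (Poly_Mapping.lookup P m) \<otimes> mon m
                         \<oplus> \<phi> (Poly_Mapping.lookup Q m) \<otimes> mon m)"
    by (rule add.finprod_cong') (use V mon_closed in \<open>auto simp: lookup_add coeff_add l_distr Pi_def\<close>)
  also have "\<dots> = (\<Oplus>m \<in> ?S. \<phi> (Poly_Mapping.lookup P m) \<otimes> mon m)
      \<oplus> (\<Oplus>m \<in> ?S. \<phi> (Poly_Mapping.lookup Q m) \<otimes> mon m)"
    using V mon_closed by (intro finsum_addf) (auto simp: Pi_def)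
  also have "\<dots> = mpoly_eval L \<phi> a P \<oplus> mpoly_eval L \<phi> a Q"
    using V eval_superset[of ?S P] eval_superset[of ?S Q] by simp
  finally show ?thesis .
qed

lemma eval_mult:
  assumes P: "P \<in> carrier (mpoly_ring V)" and Q: "Q \<in> carrier (mpoly_ring V)"
  shows "mpoly_eval L \<phi> a (P * Q) = mpoly_eval L \<phi> a P \<otimes> mpoly_eval L \<phi> a Q"
  using P
proof (induction P rule: mpoly_ring_induct)
  case (monomial m c)
  show ?case
    using Q
  proof (induction Q rule: mpoly_ring_induct)
    case (monomial n d)
    have "Poly_Mapping.keys (m + n) \<subseteq> V"
      using monomial \<open>Poly_Mapping.keys m \<subseteq> V\<close> keys_add[of m n] by blast
    then have "mpoly_eval L \<phi> a (Poly_Mapping.single m c * Poly_Mapping.single n d)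
        = \<phi> c \<otimes> \<phi> d \<otimes> (mon m \<otimes> mon n)"
      using monomial \<open>Poly_Mapping.keys m \<subseteq> V\<close>
      by (simp add: mult_single eval_single coeff_mult mon_add)
    also have "\<dots> = \<phi> c \<otimes> mon m \<otimes> (\<phi> d \<otimes> mon n)"
      using monomial \<open>Poly_Mapping.keys m \<subseteq> V\<close> mon_closed by (simp add: m_ac)
    finally show ?case
      using monomial \<open>Poly_Mapping.keys m \<subseteq> V\<close> by (simp add: eval_single)
  next
    case (add A B)
    then show ?case
      using monomial
      by (simp add: distrib_left eval_add mpoly_mult_closed mpoly_single_closed eval_closed r_distr)
  qed (use monomial mon_closed in \<open>simp add: eval_zero eval_single\<close>)
next
  case (add A B)
  then show ?case
    using Q by (simp add: distrib_right eval_add mpoly_mult_closed eval_closed l_distr)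
qed (use Q eval_closed in \<open>simp add: eval_zero\<close>)

lemma eval_hom: "mpoly_eval L \<phi> a \<in> ring_hom (mpoly_ring V) L"
  using eval_Const[of 1]
  by (intro ring_hom_memI) (simp_all add: eval_closed eval_add eval_mult Const_def)

text \<open>
  The uniqueness half of the universal property. Compositions of substitutions and ring
  homomorphisms are identified through it, by comparing their values on constants and variables.
\<close>

lemma hom_eq_eval:
  assumes h: "h \<in> ring_hom (mpoly_ring V) L"
    and hc: "\<And>c. h (Const c) = \<phi> c" and hv: "\<And>v. v \<in> V \<Longrightarrow> h (Var v) = a v"
    and P: "P \<in> carrier (mpoly_ring V)"
  shows "h P = mpoly_eval L \<phi> a P"
  using P
proof (induction P rule: mpoly_ring_induct_generators)
  case (add A B)
  then show ?case using ring_hom_add[OF h] by (simp add: eval_add)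
next
  case (mult A B)
  then show ?case using ring_hom_mult[OF h] by (simp add: eval_mult)
qed (simp_all add: hc hv eval_Const eval_Var)

end

lemma cring_ring_of_type_algebra: "cring (ring_of_type_algebra :: 'a::comm_ring_1 ring)"
  by (rule cring_from_type_algebra)

lemma Const_add: "Const (c + d) = Const c + Const d"
  by (simp add: Const_def single_add)

lemma Const_mult: "Const (c * d) = Const c * Const d"
  by (simp add: Const_def mult_single)

lemma Const_one: "Const 1 = 1"
  by (simp add: Const_def)

lemma Const_hom: "Const \<in> ring_hom ring_of_type_algebra (mpoly_ring V)"
  by (rule ring_hom_memI) (simp_all add: Const_add Const_mult Const_one mpoly_Const_closed)

lemma Const_hom_type: "Const \<in> ring_hom ring_of_type_algebra ring_of_type_algebra"
  by (rule ring_hom_memI) (simp_all add: Const_add Const_mult Const_one)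

lemma evaluation_type_algebra:
  "evaluation (ring_of_type_algebra :: ('w, 'k::field) mpoly ring) Const a V"
  by (intro evaluation.intro evaluation_axioms.intro cring_ring_of_type_algebra Const_hom_type) simp

lemma evaluation_at_point: "evaluation (ring_of_type_algebra :: 'k::field ring) id p V"
  by (intro evaluation.intro evaluation_axioms.intro cring_ring_of_type_algebra)
    (auto intro!: ring_hom_memI)

lemma eval_at_point_diff:
  fixes P :: "('v, 'k::field) mpoly"
  assumes "P \<in> carrier (mpoly_ring V)" "Q \<in> carrier (mpoly_ring V)"
  shows "mpoly_eval ring_of_type_algebra id p (P - Q)
    = mpoly_eval ring_of_type_algebra id p P - mpoly_eval ring_of_type_algebra id p Q"
  using evaluation.eval_add[OF evaluation_at_point mpoly_diff_closed[OF assms] assms(2), of p]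
  by (simp add: eq_diff_eq)

lemma eval_at_point_minor:
  fixes p :: "'i \<times> 'x \<Rightarrow> 'k::field"
  shows "mpoly_eval ring_of_type_algebra id p (Var (i, x) * Var (j, y) - Var (i, y) * Var (j, x))
    = column p x i * column p y j - column p y i * column p x j"
proof -
  note Var = evaluation.eval_Var[OF evaluation_at_point, of _ UNIV, simplified]
  have closed: "P \<in> carrier (mpoly_ring UNIV)" for P :: "('i \<times> 'x, 'k) mpoly"
    by (simp add: carrier_mpoly_ring)
  show ?thesis
    using evaluation.eval_mult[OF evaluation_at_point closed closed, of p]
    by (simp add: eval_at_point_diff[OF closed closed] Var column_def)
qed

lemma eval_at_point_Var:
  fixes p :: "'v \<Rightarrow> 'k::field"
  shows "mpoly_eval ring_of_type_algebra id p (Var v) = p v"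
  using evaluation.eval_Var[OF evaluation_at_point, of v UNIV] by simp

section \<open>Ideals of polynomial rings\<close>

lemma ideal_add: "ideal J (mpoly_ring V) \<Longrightarrow> P \<in> J \<Longrightarrow> Q \<in> J \<Longrightarrow> P + Q \<in> J"
  using additive_subgroup.a_closed[OF ideal.axioms(1), of J "mpoly_ring V" P Q] by simp

lemma ideal_zero: "ideal J (mpoly_ring V) \<Longrightarrow> 0 \<in> J"
  using additive_subgroup.zero_closed[OF ideal.axioms(1), of J "mpoly_ring V"] by simp

lemma ideal_mult:
  "ideal J (mpoly_ring V) \<Longrightarrow> P \<in> J \<Longrightarrow> Q \<in> carrier (mpoly_ring V) \<Longrightarrow> P * Q \<in> J"
  using ideal.I_r_closed[of J "mpoly_ring V" P Q] by simp

lemma ideal_mult_left: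
  "ideal J (mpoly_ring V) \<Longrightarrow> P \<in> J \<Longrightarrow> Q \<in> carrier (mpoly_ring V) \<Longrightarrow> Q * P \<in> J"
  using ideal.I_l_closed[of J "mpoly_ring V" P Q] by simp

lemma a_kernel_ideal:
  assumes "ring R" "ring S" "h \<in> ring_hom R S"
  shows "ideal {a \<in> carrier R. h a = \<zero>\<^bsub>S\<^esub>} R"
  using ring_hom_ring.kernel_is_ideal[OF ring_hom_ringI2[OF assms]] by (simp add: a_kernel_def')

lemma primeideal_kernel:
  fixes h :: "'a \<Rightarrow> 'b::idom"
  assumes R: "cring R" and h: "h \<in> ring_hom R ring_of_type_algebra"
  shows "primeideal {a \<in> carrier R. h a = 0} R"
proof (rule primeidealI[OF _ R])
  show "ideal {a \<in> carrier R. h a = 0} R"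
    using a_kernel_ideal[OF cring.axioms(1)[OF R] ring_from_type_algebra h] by simp
  have "\<one>\<^bsub>R\<^esub> \<in> carrier R" "h \<one>\<^bsub>R\<^esub> \<noteq> 0"
    using ring_hom_one[OF h] monoid.one_closed[OF ring.is_monoid[OF cring.axioms(1)[OF R]]]
    by simp_all
  then show "carrier R \<noteq> {a \<in> carrier R. h a = 0}" by blast
  fix a b assume "a \<in> carrier R" "b \<in> carrier R" "a \<otimes>\<^bsub>R\<^esub> b \<in> {a \<in> carrier R. h a = 0}"
  then show "a \<in> {a \<in> carrier R. h a = 0} \<or> b \<in> {a \<in> carrier R. h a = 0}"
    using ring_hom_mult[OF h, of a b] by simp
qed

lemma zero_set_genideal:
  fixes S :: "('v, 'k::field) mpoly set"
  assumes S: "S \<subseteq> carrier (mpoly_ring V)"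
  shows "zero_set V (Idl\<^bsub>mpoly_ring V\<^esub> S)
    = {p \<in> V \<rightarrow>\<^sub>E UNIV. \<forall>P\<in>S. mpoly_eval ring_of_type_algebra id p P = 0}"
proof -
  have "mpoly_eval ring_of_type_algebra id p P = 0"
    if van: "\<forall>P\<in>S. mpoly_eval ring_of_type_algebra id p P = 0"
      and P: "P \<in> Idl\<^bsub>mpoly_ring V\<^esub> S" for p P
  proof -
    have "ideal {P \<in> carrier (mpoly_ring V). mpoly_eval ring_of_type_algebra id p P = 0}
        (mpoly_ring V)"
      using a_kernel_ideal[OF ring_mpoly_ring ring_from_type_algebra
          evaluation.eval_hom[OF evaluation_at_point]] by simp
    then have "Idl\<^bsub>mpoly_ring V\<^esub> S
        \<subseteq> {P \<in> carrier (mpoly_ring V). mpoly_eval ring_of_type_algebra id p P = 0}"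
      by (rule ring.genideal_minimal[OF ring_mpoly_ring]) (use S van in blast)
    then show ?thesis using P by blast
  qed
  moreover have "S \<subseteq> Idl\<^bsub>mpoly_ring V\<^esub> S"
    by (rule ring.genideal_self[OF ring_mpoly_ring S])
  ultimately show ?thesis
    unfolding zero_set_def by blast
qed

section \<open>Kernels of monomial substitutions\<close>

text \<open>
  The exponent vector of the monomial that arises from \<open>m\<close> when each variable \<open>v\<close> is replaced
  by the monomial with exponent vector \<open>e v\<close>.
\<close>

definition exponent_subst :: "('v \<Rightarrow> ('w \<Rightarrow>\<^sub>0 nat)) \<Rightarrow> ('v \<Rightarrow>\<^sub>0 nat) \<Rightarrow> ('w \<Rightarrow>\<^sub>0 nat)" where
  "exponent_subst e m =
     (\<Sum>v\<in>Poly_Mapping.keys m. Poly_Mapping.map ((*) (Poly_Mapping.lookup m v)) (e v))"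

lemma lookup_exponent_subst:
  assumes "finite S" "Poly_Mapping.keys m \<subseteq> S"
  shows "Poly_Mapping.lookup (exponent_subst e m) w
    = (\<Sum>v\<in>S. Poly_Mapping.lookup m v * Poly_Mapping.lookup (e v) w)"
proof -
  have "Poly_Mapping.lookup (exponent_subst e m) w
    = (\<Sum>v\<in>Poly_Mapping.keys m. Poly_Mapping.lookup m v * Poly_Mapping.lookup (e v) w)"
    by (auto simp: exponent_subst_def lookup_sum map.rep_eq when_def intro!: sum.cong)
  also have "\<dots> = (\<Sum>v\<in>S. Poly_Mapping.lookup m v * Poly_Mapping.lookup (e v) w)"
    by (rule sum.mono_neutral_left) (use assms in \<open>auto simp: in_keys_iff\<close>)
  finally show ?thesis .
qed

lemma exponent_subst_zero [simp]: "exponent_subst e 0 = 0"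
  by (simp add: exponent_subst_def)

lemma exponent_subst_add: "exponent_subst e (m + n) = exponent_subst e m + exponent_subst e n"
proof (rule poly_mapping_eqI)
  fix w
  let ?S = "Poly_Mapping.keys m \<union> Poly_Mapping.keys n"
  show "Poly_Mapping.lookup (exponent_subst e (m + n)) w
      = Poly_Mapping.lookup (exponent_subst e m + exponent_subst e n) w"
    using keys_add[of m n]
    by (simp add: lookup_add lookup_exponent_subst[of ?S] sum.distrib[symmetric] algebra_simps)
qed

lemma exponent_subst_single: "exponent_subst e (Poly_Mapping.single v 1) = e v"
  by (rule poly_mapping_eqI) (simp add: lookup_exponent_subst[of "{v}"])

text \<open>
  Variables outside \<open>W\<close> are sent to 0. So every monomial goes to a monomial or to 0, and the
  kernel of such a map can be described combinatorially.
\<close>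

definition monomial_subst ::
    "'v set \<Rightarrow> ('v \<Rightarrow> ('w \<Rightarrow>\<^sub>0 nat)) \<Rightarrow> ('v, 'k::field) mpoly \<Rightarrow> ('w, 'k) mpoly" where
  "monomial_subst W e = mpoly_eval ring_of_type_algebra Const
     (\<lambda>v. if v \<in> W then Poly_Mapping.single (e v) 1 else 0)"

lemma monomial_subst_hom: "monomial_subst W e \<in> ring_hom (mpoly_ring V) ring_of_type_algebra"
  unfolding monomial_subst_def by (rule evaluation.eval_hom[OF evaluation_type_algebra])

lemma monomial_subst_Const: "monomial_subst W e (Const c) = Const c"
  unfolding monomial_subst_def by (rule evaluation.eval_Const[OF evaluation_type_algebra])

lemma monomial_subst_Var:
  "monomial_subst W e (Var v) = (if v \<in> W then Poly_Mapping.single (e v) 1 else 0)"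
  unfolding monomial_subst_def
  by (rule evaluation.eval_Var[OF evaluation_type_algebra, of v UNIV]) simp

lemma monomial_subst_add: "monomial_subst W e (P + Q) = monomial_subst W e P + monomial_subst W e Q"
  and monomial_subst_mult: "monomial_subst W e (P * Q) = monomial_subst W e P * monomial_subst W e Q"
  using ring_hom_add[OF monomial_subst_hom[of W e UNIV], of P Q]
    ring_hom_mult[OF monomial_subst_hom[of W e UNIV], of P Q]
  by (simp_all add: carrier_mpoly_ring)

lemma monomial_subst_uminus: "monomial_subst W e (- P) = - monomial_subst W e P"
proof -
  have "monomial_subst W e 0 = 0"
    using monomial_subst_add[of W e 0 0] by simp
  then have "monomial_subst W e P + monomial_subst W e (- P) = 0"
    by (simp flip: monomial_subst_add)
  then show ?thesis by (simp add: add_eq_0_iff)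
qed

lemma monomial_subst_diff: "monomial_subst W e (P - Q) = monomial_subst W e P - monomial_subst W e Q"
  using monomial_subst_add[of W e P "- Q"] by (simp add: monomial_subst_uminus)

lemma monomial_subst_single:
  "monomial_subst W e (Poly_Mapping.single m c)
    = (if Poly_Mapping.keys m \<subseteq> W then Poly_Mapping.single (exponent_subst e m) c else 0)"
proof -
  have "Poly_Mapping.keys m \<subseteq> UNIV" by simp
  then show ?thesis
  proof (induction m rule: monomial_induct)
    case zero
    show ?case using monomial_subst_Const[of W e c] by (simp add: Const_def)
  next
    case (add_single m v)
    then show ?case
      unfolding Var_mult_single[symmetric] keys_single_add exponent_subst_add exponent_subst_single
      by (simp add: monomial_subst_mult monomial_subst_Var mult_single)
  qed
qed

text \<open>
  The coefficient of an output monomial collects the coefficients in its fibre. A vanishing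
  image therefore forces cancellation inside each fibre.
\<close>

lemma lookup_monomial_subst:
  fixes P :: "('v, 'k::field) mpoly"
  shows "Poly_Mapping.lookup (monomial_subst W e P) w
    = (\<Sum>m\<in>Poly_Mapping.keys P. Poly_Mapping.lookup P m
         when Poly_Mapping.keys m \<subseteq> W \<and> exponent_subst e m = w)"
proof -
  have "P \<in> carrier (mpoly_ring UNIV)" by (simp add: carrier_mpoly_ring)
  then show ?thesis
  proof (induction P rule: mpoly_ring_induct)
    case zero
    show ?case using monomial_subst_single[of W e 0 "0 :: 'k"] by simp
  next
    case (monomial m c)
    show ?case by (simp add: monomial_subst_single lookup_single when_def)
  next
    case (add A B)
    have "(\<Sum>m\<in>Poly_Mapping.keys (A + B). Poly_Mapping.lookup (A + B) m
           when Poly_Mapping.keys m \<subseteq> W \<and> exponent_subst e m = w)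
      = (\<Sum>m\<in>Poly_Mapping.keys A. Poly_Mapping.lookup A m
           when Poly_Mapping.keys m \<subseteq> W \<and> exponent_subst e m = w)
      + (\<Sum>m\<in>Poly_Mapping.keys B. Poly_Mapping.lookup B m
           when Poly_Mapping.keys m \<subseteq> W \<and> exponent_subst e m = w)"
      by (rule setsum_keys_plus_distrib) (simp_all add: when_def)
    with add show ?case by (simp add: monomial_subst_add lookup_add)
  qed
qed

text \<open>
  The kernel of a monomial substitution is spanned by the monomials that go to 0 and by the
  differences of monomials with the same image. Indeed, a term \<open>m\<close> of an element \<open>P\<close> of the
  kernel is either killed itself, or its coefficient must be cancelled by another term \<open>m'\<close> of
  \<open>P\<close> with the same image; in both cases subtracting a multiple of \<open>m\<close> or of \<open>m - m'\<close> removes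
  \<open>m\<close> and creates no new term. The induction is on the number of terms.
\<close>

lemma kernel_monomial_subst_subset:
  fixes P :: "('v, 'k::field) mpoly"
  assumes J: "ideal J (mpoly_ring V)"
    and vanish: "\<And>v. v \<in> V - W \<Longrightarrow> Var v \<in> J"
    and binomial: "\<And>m m'. Poly_Mapping.keys m \<subseteq> V \<inter> W \<Longrightarrow> Poly_Mapping.keys m' \<subseteq> V \<inter> W \<Longrightarrow>
          exponent_subst e m = exponent_subst e m' \<Longrightarrow>
          Poly_Mapping.single m 1 - Poly_Mapping.single m' 1 \<in> J"
    and "P \<in> carrier (mpoly_ring V)" "monomial_subst W e P = 0"
  shows "P \<in> J"
  using assms(4,5)
proof (induction "card (Poly_Mapping.keys P)" arbitrary: P rule: less_induct)
  case less
  note V = less.prems(1)[unfolded carrier_mpoly_ring]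
  show ?case
  proof (cases "P = 0")
    case True
    then show ?thesis using ideal_zero[OF J] by simp
  next
    case False
    then obtain m where m: "m \<in> Poly_Mapping.keys P" by fastforce
    let ?c = "Poly_Mapping.lookup P m"
    have "\<exists>T\<in>J. monomial_subst W e T = 0 \<and>
        Poly_Mapping.keys (P - T) \<subseteq> Poly_Mapping.keys P - {m}"
    proof (cases "Poly_Mapping.keys m \<subseteq> W")
      case False
      then obtain v where v: "v \<in> Poly_Mapping.keys m" "v \<in> V - W"
        using V m by auto
      obtain n where n: "m = Poly_Mapping.single v 1 + n"
          "Poly_Mapping.keys n \<subseteq> Poly_Mapping.keys m"
        using monomial_extract[OF v(1)] .
      then have "Var v * Poly_Mapping.single n ?c \<in> J"
        using V m by (intro ideal_mult[OF J vanish[OF v(2)]] mpoly_single_closed) blast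
      then have "Poly_Mapping.single m ?c \<in> J"
        unfolding Var_mult_single n(1)[symmetric] .
      then show ?thesis
        using False by (intro bexI[of _ "Poly_Mapping.single m ?c"])
          (auto simp: monomial_subst_single in_keys_iff lookup_minus lookup_single when_def split: if_splits)
    next
      case True
      have "\<exists>m'\<in>Poly_Mapping.keys P. m' \<noteq> m \<and> Poly_Mapping.keys m' \<subseteq> W \<and>
          exponent_subst e m' = exponent_subst e m"
      proof (rule ccontr)
        assume no: "\<not> ?thesis"
        have "Poly_Mapping.lookup (monomial_subst W e P) (exponent_subst e m)
            = (\<Sum>m'\<in>Poly_Mapping.keys P. if m' = m then ?c else 0)"
          unfolding lookup_monomial_subst using no True by (intro sum.cong) (auto simp: when_def)
        also have "\<dots> = ?c" using m by simp
        finally show False using less.prems(2) m by (simp add: in_keys_iff)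
      qed
      then obtain m' where m': "m' \<in> Poly_Mapping.keys P" "m' \<noteq> m" "Poly_Mapping.keys m' \<subseteq> W"
          "exponent_subst e m' = exponent_subst e m"
        by metis
      define T where "T = Poly_Mapping.single m ?c - Poly_Mapping.single m' ?c"
      have "(Poly_Mapping.single m 1 - Poly_Mapping.single m' 1) * Const ?c \<in> J"
      proof (rule ideal_mult[OF J _ mpoly_Const_closed])
        have "Poly_Mapping.keys m \<subseteq> V \<inter> W" using V m True by simp
        moreover have "Poly_Mapping.keys m' \<subseteq> V \<inter> W" using V m'(1,3) by simp
        ultimately show "Poly_Mapping.single m 1 - Poly_Mapping.single m' 1 \<in> J"
          by (rule binomial[OF _ _ m'(4)[symmetric]])
      qed
      also have "(Poly_Mapping.single m 1 - Poly_Mapping.single m' 1) * Const ?c = T"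
        by (simp add: T_def Const_def mult_single left_diff_distrib)
      finally have "T \<in> J" .
      moreover have "monomial_subst W e T = 0"
        using True m' by (simp add: T_def monomial_subst_diff monomial_subst_single)
      moreover have "Poly_Mapping.keys (P - T) \<subseteq> Poly_Mapping.keys P - {m}"
      proof
        fix k assume "k \<in> Poly_Mapping.keys (P - T)"
        moreover have "Poly_Mapping.lookup T k = (if k = m then ?c else if k = m' then - ?c else 0)"
          using m'(2) by (simp add: T_def lookup_minus lookup_single)
        ultimately show "k \<in> Poly_Mapping.keys P - {m}"
          using m'(1) by (cases "k = m"; cases "k = m'") (simp_all add: in_keys_iff lookup_minus)
      qed
      ultimately show ?thesis by blast
    qed
    then obtain T where T: "T \<in> J" "monomial_subst W e T = 0"
        "Poly_Mapping.keys (P - T) \<subseteq> Poly_Mapping.keys P - {m}"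
      by blast
    have "Poly_Mapping.keys (P - T) \<subset> Poly_Mapping.keys P"
      using T(3) m by blast
    then have "card (Poly_Mapping.keys (P - T)) < card (Poly_Mapping.keys P)"
      by (simp add: psubset_card_mono)
    moreover have "P - T \<in> carrier (mpoly_ring V)"
      using V T(3) by (auto simp: carrier_mpoly_ring)
    ultimately have "P - T \<in> J"
      using less.hyps[of "P - T"] less.prems(2) T(2) by (simp add: monomial_subst_diff)
    then show ?thesis
      using ideal_add[OF J _ T(1), of "P - T"] by simp
  qed
qed

text \<open>
  The case of the zero ideal: with singleton fibres there is nothing to cancel.
\<close>

lemma monomial_subst_injective:
  fixes P :: "('v, 'k::field) mpoly"
  assumes "inj_on (exponent_subst e) {m. Poly_Mapping.keys m \<subseteq> V}" "V \<subseteq> W"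
    and "P \<in> carrier (mpoly_ring V)" "monomial_subst W e P = 0"
  shows "P = 0"
proof -
  have ideal: "ideal {0} (mpoly_ring V :: ('v, 'k) mpoly ring)"
    using ring.zeroideal[OF cring.axioms(1)[OF cring_mpoly_ring]] by simp
  have "P \<in> {0}"
  proof (rule kernel_monomial_subst_subset[OF ideal _ _ assms(3,4)])
    show "Var v \<in> {0}" if "v \<in> V - W" for v
      using that assms(2) by blast
    show "Poly_Mapping.single m 1 - Poly_Mapping.single m' 1 \<in> {0}"
      if "Poly_Mapping.keys m \<subseteq> V \<inter> W" "Poly_Mapping.keys m' \<subseteq> V \<inter> W"
        "exponent_subst e m = exponent_subst e m'" for m m'
    proof -
      have "m = m'"
        by (rule inj_onD[OF assms(1) that(3)]) (use that(1,2) in simp_all)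
      then show ?thesis by simp
    qed
  qed
  then show ?thesis by simp
qed

lemma exponent_subst_pos_iff:
  "0 < Poly_Mapping.lookup (exponent_subst e m) w
    \<longleftrightarrow> (\<exists>v\<in>Poly_Mapping.keys m. 0 < Poly_Mapping.lookup (e v) w)"
  unfolding lookup_exponent_subst[OF finite_keys order_refl]
  by (auto simp: in_keys_iff simp flip: neq0_conv)

text \<open>
  Recovers one exponent of \<open>m\<close> from the output exponent of \<open>w\<close>, once the other variables that
  contribute to \<open>w\<close> are known to have equal exponents in \<open>m\<close> and \<open>m'\<close>.
\<close>

lemma exponent_subst_cancel:
  assumes "finite K" "Poly_Mapping.keys m \<subseteq> K" "Poly_Mapping.keys m' \<subseteq> K" "v \<in> K"
    and eq: "exponent_subst e m = exponent_subst e m'"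
    and pos: "0 < Poly_Mapping.lookup (e v) w"
    and others: "\<And>u. u \<in> K \<Longrightarrow> u \<noteq> v \<Longrightarrow> 0 < Poly_Mapping.lookup (e u) w \<Longrightarrow>
          Poly_Mapping.lookup m u = Poly_Mapping.lookup m' u"
  shows "Poly_Mapping.lookup m v = Poly_Mapping.lookup m' v"
proof -
  let ?f = "\<lambda>m u. Poly_Mapping.lookup m u * Poly_Mapping.lookup (e u) w"
  have "?f m v + (\<Sum>u\<in>K - {v}. ?f m u) = ?f m' v + (\<Sum>u\<in>K - {v}. ?f m' u)"
    using arg_cong[OF eq, of "\<lambda>p. Poly_Mapping.lookup p w"] assms(1-4)
    by (simp add: lookup_exponent_subst[of K] sum.remove)
  moreover have "(\<Sum>u\<in>K - {v}. ?f m u) = (\<Sum>u\<in>K - {v}. ?f m' u)"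
    using others by (intro sum.cong) (auto simp flip: neq0_conv)
  ultimately show ?thesis using pos by simp
qed

section \<open>Fraction fields\<close>

text \<open>
  The shape in which the operations of a fraction field are given.
\<close>

lemma double_UN_eq_const:
  assumes "(a, b) \<in> S" "(c, d) \<in> T"
    and "\<And>a b c d. (a, b) \<in> S \<Longrightarrow> (c, d) \<in> T \<Longrightarrow> F a b c d = C"
  shows "(\<Union>(a, b)\<in>S. \<Union>(c, d)\<in>T. F a b c d) = C"
proof (rule SUP_eq_const)
  fix p assume "p \<in> S"
  moreover have "(\<Union>(c, d)\<in>T. F (fst p) (snd p) c d) = C" if "p \<in> S"
    by (rule SUP_eq_const) (use assms that in \<open>auto split: prod.splits\<close>)
  ultimately show "(case p of (a, b) \<Rightarrow> \<Union>(c, d)\<in>T. F a b c d) = C"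
    by (simp add: case_prod_unfold)
qed (use assms in auto)

context domain
begin

abbreviation denominators :: "'a set" where
  "denominators \<equiv> carrier R - {\<zero>}"

lemma denominators_mult: "b \<in> denominators \<Longrightarrow> d \<in> denominators \<Longrightarrow> b \<otimes> d \<in> denominators"
  using integral by auto

lemma equiv_frac_rel: "equiv (carrier R \<times> denominators) (frac_rel R)"
proof (rule equivI)
  show "trans (frac_rel R)"
  proof (rule transI, clarify)
    fix a b c d e f
    assume "((a, b), (c, d)) \<in> frac_rel R" "((c, d), (e, f)) \<in> frac_rel R"
    then have c: "a \<in> carrier R" "b \<in> denominators" "c \<in> carrier R" "d \<in> denominators"
        "e \<in> carrier R" "f \<in> denominators"
      and eq: "a \<otimes> d = c \<otimes> b" "c \<otimes> f = e \<otimes> d"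
      by (auto simp: frac_rel_def)
    \<comment> \<open>Transitivity is the place where zero divisors would hurt: the factor \<open>d\<close> has to be cancelled.\<close>
    have "d \<otimes> (a \<otimes> f) = (a \<otimes> d) \<otimes> f" using c by (simp add: m_ac)
    also have "\<dots> = (c \<otimes> b) \<otimes> f" by (simp only: eq)
    also have "\<dots> = (c \<otimes> f) \<otimes> b" using c by (simp add: m_ac)
    also have "\<dots> = (e \<otimes> d) \<otimes> b" by (simp only: eq)
    also have "\<dots> = d \<otimes> (e \<otimes> b)" using c by (simp add: m_ac)
    finally have "a \<otimes> f = e \<otimes> b"
      using c m_lcancel[of d "a \<otimes> f" "e \<otimes> b"] by auto
    then show "((a, b), (e, f)) \<in> frac_rel R"
      using c by (auto simp: frac_rel_def)
  qed
qed (auto simp: frac_rel_def refl_on_def sym_def)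

lemma fraction_eq_iff:
  assumes "a \<in> carrier R" "b \<in> denominators" "c \<in> carrier R" "d \<in> denominators"
  shows "fraction R a b = fraction R c d \<longleftrightarrow> a \<otimes> d = c \<otimes> b"
  unfolding fraction_def
  using eq_equiv_class_iff[OF equiv_frac_rel, of "(a, b)" "(c, d)"] assms
  by (auto simp: frac_rel_def)

lemma fraction_closed:
  "a \<in> carrier R \<Longrightarrow> b \<in> denominators \<Longrightarrow> fraction R a b \<in> carrier (fraction_field R)"
  by (auto simp: fraction_field_def fraction_def intro!: quotientI)

lemma fraction_cases:
  assumes "x \<in> carrier (fraction_field R)"
  obtains a b where "a \<in> carrier R" "b \<in> denominators" "x = fraction R a b"
  using assms by (auto simp: fraction_field_def fraction_def elim!: quotientE)

lemma mem_fraction_iff: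
  assumes "a \<in> carrier R" "b \<in> denominators"
  shows "(c, d) \<in> fraction R a b \<longleftrightarrow> c \<in> carrier R \<and> d \<in> denominators \<and> a \<otimes> d = c \<otimes> b"
  using assms by (auto simp: fraction_def frac_rel_def)

text \<open>
  The operations are unions over all pairs of representatives. Cross multiplication shows that
  all classes in such a union coincide, so the union is the class of any one choice.
\<close>

lemma fraction_mult:
  assumes "a \<in> carrier R" "b \<in> denominators" "c \<in> carrier R" "d \<in> denominators"
  shows "fraction R a b \<otimes>\<^bsub>fraction_field R\<^esub> fraction R c d = fraction R (a \<otimes> c) (b \<otimes> d)"
proof -
  have "fraction R (a' \<otimes> c') (b' \<otimes> d') = fraction R (a \<otimes> c) (b \<otimes> d)"
    if "(a', b') \<in> fraction R a b" "(c', d') \<in> fraction R c d" for a' b' c' d'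
  proof -
    have r: "a' \<in> carrier R" "b' \<in> denominators" "c' \<in> carrier R" "d' \<in> denominators"
        "a \<otimes> b' = a' \<otimes> b" "c \<otimes> d' = c' \<otimes> d"
      using that assms by (auto simp: mem_fraction_iff)
    have "(a' \<otimes> c') \<otimes> (b \<otimes> d) = (a' \<otimes> b) \<otimes> (c' \<otimes> d)"
      using assms r(1-4) by (simp add: m_ac)
    also have "\<dots> = (a \<otimes> b') \<otimes> (c \<otimes> d')"
      by (simp only: r(5,6))
    also have "\<dots> = (a \<otimes> c) \<otimes> (b' \<otimes> d')"
      using assms r(1-4) by (simp add: m_ac)
    finally show ?thesis
      using assms r(1-4) denominators_mult by (subst fraction_eq_iff) auto
  qed
  moreover have "(a, b) \<in> fraction R a b" "(c, d) \<in> fraction R c d"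
    using assms by (auto simp: mem_fraction_iff)
  ultimately show ?thesis
    unfolding fraction_field_def ring_record_simps by (rule double_UN_eq_const[rotated 2])
qed

lemma fraction_add:
  assumes "a \<in> carrier R" "b \<in> denominators" "c \<in> carrier R" "d \<in> denominators"
  shows "fraction R a b \<oplus>\<^bsub>fraction_field R\<^esub> fraction R c d
    = fraction R (a \<otimes> d \<oplus> c \<otimes> b) (b \<otimes> d)"
proof -
  have "fraction R (a' \<otimes> d' \<oplus> c' \<otimes> b') (b' \<otimes> d') = fraction R (a \<otimes> d \<oplus> c \<otimes> b) (b \<otimes> d)"
    if "(a', b') \<in> fraction R a b" "(c', d') \<in> fraction R c d" for a' b' c' d'
  proof -
    have r: "a' \<in> carrier R" "b' \<in> denominators" "c' \<in> carrier R" "d' \<in> denominators"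
        "a \<otimes> b' = a' \<otimes> b" "c \<otimes> d' = c' \<otimes> d"
      using that assms by (auto simp: mem_fraction_iff)
    have "(a' \<otimes> d' \<oplus> c' \<otimes> b') \<otimes> (b \<otimes> d)
        = (a' \<otimes> b) \<otimes> (d \<otimes> d') \<oplus> (c' \<otimes> d) \<otimes> (b \<otimes> b')"
      using assms r(1-4) by (simp add: l_distr r_distr m_ac)
    also have "\<dots> = (a \<otimes> b') \<otimes> (d \<otimes> d') \<oplus> (c \<otimes> d') \<otimes> (b \<otimes> b')"
      by (simp only: r(5,6))
    also have "\<dots> = (a \<otimes> d \<oplus> c \<otimes> b) \<otimes> (b' \<otimes> d')"
      using assms r(1-4) by (simp add: l_distr r_distr m_ac)
    finally show ?thesis
      using assms r(1-4) denominators_mult by (subst fraction_eq_iff) auto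
  qed
  moreover have "(a, b) \<in> fraction R a b" "(c, d) \<in> fraction R c d"
    using assms by (auto simp: mem_fraction_iff)
  ultimately show ?thesis
    unfolding fraction_field_def ring_record_simps by (rule double_UN_eq_const[rotated 2])
qed

lemma fraction_one: "\<one>\<^bsub>fraction_field R\<^esub> = fraction R \<one> \<one>"
  and fraction_zero: "\<zero>\<^bsub>fraction_field R\<^esub> = fraction R \<zero> \<one>"
  by (simp_all add: fraction_field_def)

lemma one_denominator: "\<one> \<in> denominators"
  by simp

lemma fraction_eq_zero_iff:
  "a \<in> carrier R \<Longrightarrow> b \<in> denominators \<Longrightarrow>
    fraction R a b = \<zero>\<^bsub>fraction_field R\<^esub> \<longleftrightarrow> a = \<zero>"
  by (simp add: fraction_zero fraction_eq_iff)

lemma field_fraction_field: "field (fraction_field R)"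
proof (rule cring.cring_fieldI2)
  show "cring (fraction_field R)"
  proof (rule cringI)
    show "abelian_group (fraction_field R)"
    proof (rule abelian_groupI)
      fix x y assume "x \<in> carrier (fraction_field R)" "y \<in> carrier (fraction_field R)"
      then obtain a b c d where "a \<in> carrier R" "b \<in> denominators"
          "c \<in> carrier R" "d \<in> denominators" "x = fraction R a b" "y = fraction R c d"
        by (metis fraction_cases)
      then show "x \<oplus>\<^bsub>fraction_field R\<^esub> y \<in> carrier (fraction_field R)"
        using denominators_mult[of b d] by (simp add: fraction_add fraction_closed)
    next
      show "\<zero>\<^bsub>fraction_field R\<^esub> \<in> carrier (fraction_field R)"
        by (simp add: fraction_zero fraction_closed)
    next
      fix x y z
      assume "x \<in> carrier (fraction_field R)" "y \<in> carrier (fraction_field R)"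
        "z \<in> carrier (fraction_field R)"
      then obtain a b c d e f where
          c: "a \<in> carrier R" "b \<in> denominators" "c \<in> carrier R" "d \<in> denominators"
            "e \<in> carrier R" "f \<in> denominators"
          and x: "x = fraction R a b" "y = fraction R c d" "z = fraction R e f"
        by (metis fraction_cases)
      have n: "b \<otimes> d \<in> denominators" "d \<otimes> f \<in> denominators"
        using c denominators_mult by blast+
      have "x \<oplus>\<^bsub>fraction_field R\<^esub> y \<oplus>\<^bsub>fraction_field R\<^esub> z
          = fraction R ((a \<otimes> d \<oplus> c \<otimes> b) \<otimes> f \<oplus> e \<otimes> (b \<otimes> d)) (b \<otimes> d \<otimes> f)"
        unfolding x using c n by (simp add: fraction_add)
      also have "(a \<otimes> d \<oplus> c \<otimes> b) \<otimes> f \<oplus> e \<otimes> (b \<otimes> d) = a \<otimes> (d \<otimes> f) \<oplus> (c \<otimes> f \<oplus> e \<otimes> d) \<otimes> b"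
        using c by (simp add: l_distr r_distr m_ac a_ac)
      also have "b \<otimes> d \<otimes> f = b \<otimes> (d \<otimes> f)"
        using c by (simp add: m_assoc)
      also have "fraction R (a \<otimes> (d \<otimes> f) \<oplus> (c \<otimes> f \<oplus> e \<otimes> d) \<otimes> b) (b \<otimes> (d \<otimes> f))
          = x \<oplus>\<^bsub>fraction_field R\<^esub> (y \<oplus>\<^bsub>fraction_field R\<^esub> z)"
        unfolding x using c n by (simp add: fraction_add)
      finally show "x \<oplus>\<^bsub>fraction_field R\<^esub> y \<oplus>\<^bsub>fraction_field R\<^esub> z
          = x \<oplus>\<^bsub>fraction_field R\<^esub> (y \<oplus>\<^bsub>fraction_field R\<^esub> z)" .
    next
      fix x y assume "x \<in> carrier (fraction_field R)" "y \<in> carrier (fraction_field R)"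
      then obtain a b c d where "a \<in> carrier R" "b \<in> denominators"
          "c \<in> carrier R" "d \<in> denominators" "x = fraction R a b" "y = fraction R c d"
        by (metis fraction_cases)
      then show "x \<oplus>\<^bsub>fraction_field R\<^esub> y = y \<oplus>\<^bsub>fraction_field R\<^esub> x"
        by (simp add: fraction_add a_comm[of "a \<otimes> d"] m_comm[of b d])
    next
      fix x assume "x \<in> carrier (fraction_field R)"
      then obtain a b where c: "a \<in> carrier R" "b \<in> denominators" and x: "x = fraction R a b"
        by (rule fraction_cases)
      show "\<zero>\<^bsub>fraction_field R\<^esub> \<oplus>\<^bsub>fraction_field R\<^esub> x = x"
        using c by (simp add: x fraction_zero fraction_add)
      have "fraction R (\<ominus> a) b \<oplus>\<^bsub>fraction_field R\<^esub> x = fraction R (\<ominus> a \<otimes> b \<oplus> a \<otimes> b) (b \<otimes> b)"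
        using c by (simp add: x fraction_add)
      also have "\<dots> = \<zero>\<^bsub>fraction_field R\<^esub>"
        using c denominators_mult[of b b] by (subst fraction_eq_zero_iff) (auto simp: l_minus l_neg)
      finally show "\<exists>y\<in>carrier (fraction_field R).
          y \<oplus>\<^bsub>fraction_field R\<^esub> x = \<zero>\<^bsub>fraction_field R\<^esub>"
        using c by (auto intro!: bexI[of _ "fraction R (\<ominus> a) b"] fraction_closed)
    qed
    show "comm_monoid (fraction_field R)"
    proof (rule comm_monoidI)
      fix x y
      assume "x \<in> carrier (fraction_field R)" "y \<in> carrier (fraction_field R)"
      then obtain a b c d where "a \<in> carrier R" "b \<in> denominators"
          "c \<in> carrier R" "d \<in> denominators" "x = fraction R a b" "y = fraction R c d"
        by (metis fraction_cases)
      then show "x \<otimes>\<^bsub>fraction_field R\<^esub> y \<in> carrier (fraction_field R)"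
          "x \<otimes>\<^bsub>fraction_field R\<^esub> y = y \<otimes>\<^bsub>fraction_field R\<^esub> x"
        using denominators_mult[of b d] by (simp_all add: fraction_mult fraction_closed m_comm)
    next
      fix x y z
      assume "x \<in> carrier (fraction_field R)" "y \<in> carrier (fraction_field R)"
        "z \<in> carrier (fraction_field R)"
      then obtain a b c d e f where
          c: "a \<in> carrier R" "b \<in> denominators" "c \<in> carrier R" "d \<in> denominators"
            "e \<in> carrier R" "f \<in> denominators"
          and x: "x = fraction R a b" "y = fraction R c d" "z = fraction R e f"
        by (metis fraction_cases)
      have "b \<otimes> d \<in> denominators" "d \<otimes> f \<in> denominators"
        using c denominators_mult by blast+
      then show "x \<otimes>\<^bsub>fraction_field R\<^esub> y \<otimes>\<^bsub>fraction_field R\<^esub> z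
          = x \<otimes>\<^bsub>fraction_field R\<^esub> (y \<otimes>\<^bsub>fraction_field R\<^esub> z)"
        unfolding x using c by (simp add: fraction_mult m_assoc)
    next
      show "\<one>\<^bsub>fraction_field R\<^esub> \<in> carrier (fraction_field R)"
        by (simp add: fraction_one fraction_closed)
    next
      fix x assume "x \<in> carrier (fraction_field R)"
      then show "\<one>\<^bsub>fraction_field R\<^esub> \<otimes>\<^bsub>fraction_field R\<^esub> x = x"
        by (elim fraction_cases) (simp add: fraction_one fraction_mult)
    qed
  next
    fix x y z
    assume "x \<in> carrier (fraction_field R)" "y \<in> carrier (fraction_field R)"
      "z \<in> carrier (fraction_field R)"
    then obtain a b c d e f where
        c: "a \<in> carrier R" "b \<in> denominators" "c \<in> carrier R" "d \<in> denominators"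
          "e \<in> carrier R" "f \<in> denominators"
        and x: "x = fraction R a b" "y = fraction R c d" "z = fraction R e f"
      by (metis fraction_cases)
    have n: "b \<otimes> d \<in> denominators" "b \<otimes> f \<in> denominators" "d \<otimes> f \<in> denominators"
      using c denominators_mult by blast+
    have n2: "(b \<otimes> f) \<otimes> (d \<otimes> f) \<in> denominators" "(b \<otimes> d) \<otimes> f \<in> denominators"
      using c n denominators_mult by blast+
    show "(x \<oplus>\<^bsub>fraction_field R\<^esub> y) \<otimes>\<^bsub>fraction_field R\<^esub> z
        = x \<otimes>\<^bsub>fraction_field R\<^esub> z \<oplus>\<^bsub>fraction_field R\<^esub> y \<otimes>\<^bsub>fraction_field R\<^esub> z"
      unfolding x using c n n2
      by (simp add: fraction_add fraction_mult fraction_eq_iff l_distr r_distr m_ac)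
  qed
next
  show "\<zero>\<^bsub>fraction_field R\<^esub> \<noteq> \<one>\<^bsub>fraction_field R\<^esub>"
    unfolding fraction_one using fraction_eq_zero_iff[of \<one> \<one>] by auto
next
  fix x assume "x \<in> carrier (fraction_field R)" and nz: "x \<noteq> \<zero>\<^bsub>fraction_field R\<^esub>"
  then obtain a b where c: "a \<in> carrier R" "b \<in> denominators" and x: "x = fraction R a b"
    by (metis fraction_cases)
  have a: "a \<in> denominators"
    using nz c by (simp add: x fraction_eq_zero_iff)
  have "x \<otimes>\<^bsub>fraction_field R\<^esub> fraction R b a = \<one>\<^bsub>fraction_field R\<^esub>"
    using c a denominators_mult[OF c(2) a]
    by (simp add: x fraction_mult fraction_one fraction_eq_iff m_comm)
  then show "\<exists>y\<in>carrier (fraction_field R). x \<otimes>\<^bsub>fraction_field R\<^esub> y = \<one>\<^bsub>fraction_field R\<^esub>"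
    using c a by (auto intro!: bexI[of _ "fraction R b a"] fraction_closed)
qed

lemma fraction_embedding_hom:
  "(\<lambda>a. fraction R a \<one>) \<in> ring_hom R (fraction_field R)"
  by (intro ring_hom_memI) (simp_all add: fraction_closed fraction_mult fraction_add fraction_one)

end

section \<open>A criterion for rationality\<close>

text \<open>
  A transcendence basis made of the classes of some of the coordinates. The condition \<open>indep\<close>
  says that these coordinates satisfy no relation on the variety. The condition \<open>gen\<close> says that
  every coordinate is a rational function \<open>f / g\<close> in them, since the class of \<open>g\<close> is invertible in
  the function field as soon as \<open>g\<close> lies outside the prime ideal.
\<close>

lemma rational_varietyI:
  fixes J :: "('v, 'k::field) mpoly set"
  assumes J: "primeideal J (mpoly_ring V)" and S: "S \<subseteq> V"
    and indep: "\<And>P. P \<in> carrier (mpoly_ring S) \<Longrightarrow> P \<in> J \<Longrightarrow> P = 0"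
    and gen: "\<And>v. v \<in> V \<Longrightarrow> \<exists>f\<in>carrier (mpoly_ring S). \<exists>g\<in>carrier (mpoly_ring S).
                g \<notin> J \<and> g * Var v - f \<in> J"
  shows "rational_variety V J"
proof -
  let ?R = "mpoly_ring V :: ('v, 'k) mpoly ring"
  let ?D = "?R Quot J"
  let ?L = "fraction_field ?D"
  define q where "q P = J +>\<^bsub>?R\<^esub> P" for P
  define \<iota> where "\<iota> P = fraction ?D (q P) \<one>\<^bsub>?D\<^esub>" for P
  define \<phi> where "\<phi> c = \<iota> (Const c)" for c
  interpret D: domain ?D by (rule primeideal.quotient_is_domain[OF J])
  interpret L: field ?L by (rule D.field_fraction_field)
  have ideal: "ideal J ?R" by (rule primeideal.axioms(1)[OF J])
  have S_sub: "P \<in> carrier ?R" if "P \<in> carrier (mpoly_ring S)" for P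
    using that S by (auto simp: carrier_mpoly_ring)

  have q_hom: "q \<in> ring_hom ?R ?D"
    unfolding q_def by (rule ideal.rcos_ring_hom[OF ideal])
  have q_closed: "q P \<in> carrier ?D" if "P \<in> carrier ?R" for P
    using ring_hom_closed[OF q_hom that] .
  have q_zero: "q P = \<zero>\<^bsub>?D\<^esub> \<longleftrightarrow> P \<in> J" if P: "P \<in> carrier ?R" for P
  proof -
    have "q 0 = \<zero>\<^bsub>?D\<^esub>"
      using ring_hom_zero[OF q_hom ring_mpoly_ring D.ring_axioms] by simp
    moreover have "P \<ominus>\<^bsub>?R\<^esub> 0 \<in> J \<longleftrightarrow> q P = q 0"
      unfolding q_def
      by (rule ring.quotient_eq_iff_same_a_r_cos[OF ring_mpoly_ring ideal P mpoly_zero_closed])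
    ultimately show ?thesis
      using mpoly_ring_minus[OF P mpoly_zero_closed] by simp
  qed
  have \<iota>_hom: "\<iota> \<in> ring_hom ?R ?L"
  proof -
    have "(\<lambda>a. fraction ?D a \<one>\<^bsub>?D\<^esub>) \<circ> q \<in> ring_hom ?R ?L"
      by (rule ring_hom_trans[OF q_hom D.fraction_embedding_hom])
    then show ?thesis by (simp add: \<iota>_def[abs_def] comp_def)
  qed
  have \<iota>_closed: "\<iota> P \<in> carrier ?L" if "P \<in> carrier ?R" for P
    using ring_hom_closed[OF \<iota>_hom that] .
  have \<iota>_zero: "\<iota> P = \<zero>\<^bsub>?L\<^esub> \<longleftrightarrow> P \<in> J" if P: "P \<in> carrier ?R" for P
    unfolding \<iota>_def
    using D.fraction_eq_zero_iff[OF q_closed[OF P] D.one_denominator] q_zero[OF P] by simp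
  have \<phi>_hom: "\<phi> \<in> ring_hom ring_of_type_algebra ?L"
  proof -
    have "\<iota> \<circ> Const \<in> ring_hom ring_of_type_algebra ?L"
      by (rule ring_hom_trans[OF Const_hom \<iota>_hom])
    then show ?thesis by (simp add: \<phi>_def[abs_def] comp_def)
  qed

  define B where "B = (\<lambda>v. \<iota> (Var v)) ` S"
  have B: "B \<subseteq> carrier ?L"
    using S by (auto simp: B_def intro!: \<iota>_closed mpoly_Var_closed)

  have alg: "algebraically_independent \<phi> ?L B"
    unfolding algebraically_independent_def
  proof (intro ballI impI)
    fix P :: "(_, 'k) mpoly"
    assume P: "P \<in> carrier (mpoly_ring B)" and zero: "mpoly_eval ?L \<phi> id P = \<zero>\<^bsub>?L\<^esub>"
    \<comment> \<open>Here \<open>P\<close> has its variables in the function field. Naming each of them by a coordinate in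
      \<open>S\<close> pulls \<open>P\<close> back to a polynomial \<open>pl P\<close>, which lies in \<open>J\<close> and so is 0; renaming in the
      other direction by \<open>ps\<close> recovers \<open>P\<close>.\<close>
    define s where "s = inv_into S (\<lambda>v. \<iota> (Var v))"
    have s: "s b \<in> S" "\<iota> (Var (s b)) = b" if "b \<in> B" for b
      using inv_into_into[of b "\<lambda>v. \<iota> (Var v)" S] f_inv_into_f[of b "\<lambda>v. \<iota> (Var v)" S] that
      unfolding s_def B_def by blast+
    interpret pull: evaluation "mpoly_ring S :: ('v, 'k) mpoly ring" Const "\<lambda>b. Var (s b)" B
      by (intro evaluation.intro evaluation_axioms.intro cring_mpoly_ring Const_hom)
        (simp add: s mpoly_Var_closed)
    interpret push: evaluation "mpoly_ring B :: (_, 'k) mpoly ring" Const "\<lambda>v. Var (\<iota> (Var v))" S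
      by (intro evaluation.intro evaluation_axioms.intro cring_mpoly_ring Const_hom)
        (simp add: B_def mpoly_Var_closed)
    interpret at: evaluation ?L \<phi> id B
      by (intro evaluation.intro evaluation_axioms.intro L.is_cring \<phi>_hom) (use B in auto)
    interpret idt: evaluation "mpoly_ring B :: (_, 'k) mpoly ring" Const Var B
      by (intro evaluation.intro evaluation_axioms.intro cring_mpoly_ring Const_hom)
        (simp add: mpoly_Var_closed)
    define pl where "pl = mpoly_eval (mpoly_ring S :: ('v, 'k) mpoly ring) Const (\<lambda>b. Var (s b))"
    define ps where "ps = mpoly_eval (mpoly_ring B :: (_, 'k) mpoly ring) Const (\<lambda>v. Var (\<iota> (Var v)))"
    have pl_hom: "pl \<in> ring_hom (mpoly_ring B) (mpoly_ring S)"
      unfolding pl_def by (rule pull.eval_hom)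
    have ps_hom: "ps \<in> ring_hom (mpoly_ring S) (mpoly_ring B)"
      unfolding ps_def by (rule push.eval_hom)
    have \<iota>_S: "\<iota> \<in> ring_hom (mpoly_ring S) ?L"
      using \<iota>_hom S_sub by (auto simp: ring_hom_def)
    have pl_P: "pl P \<in> carrier (mpoly_ring S)"
      by (rule ring_hom_closed[OF pl_hom P])
    have "(\<iota> \<circ> pl) P = mpoly_eval ?L \<phi> id P"
      by (rule at.hom_eq_eval[OF ring_hom_trans[OF pl_hom \<iota>_S] _ _ P])
        (simp_all add: pl_def pull.eval_Const pull.eval_Var s \<phi>_def)
    then have "pl P \<in> J"
      using zero \<iota>_zero[OF S_sub[OF pl_P]] by simp
    then have "pl P = 0"
      by (rule indep[OF pl_P])
    moreover have "(ps \<circ> pl) P = mpoly_eval (mpoly_ring B) Const Var P"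
      by (rule idt.hom_eq_eval[OF ring_hom_trans[OF pl_hom ps_hom] _ _ P])
        (simp_all add: pl_def ps_def pull.eval_Const pull.eval_Var push.eval_Const push.eval_Var s)
    moreover have "id P = mpoly_eval (mpoly_ring B) Const Var P"
      by (rule idt.hom_eq_eval[OF _ _ _ P]) (simp_all add: ring_hom_def)
    ultimately show "P = 0"
      using push.eval_zero by (simp add: ps_def)
  qed

  define K where "K = generate_field ?L (range \<phi> \<union> B)"
  have range: "range \<phi> \<union> B \<subseteq> carrier ?L"
    using B by (auto simp: \<phi>_def intro!: \<iota>_closed mpoly_Const_closed)
  have K_sub: "K \<subseteq> carrier ?L"
    unfolding K_def by (rule L.generate_field_incl[OF range])
  have K_S: "\<iota> P \<in> K" if "P \<in> carrier (mpoly_ring S)" for P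
    using that
  proof (induction P rule: mpoly_ring_induct_generators)
    case (Const c)
    show ?case by (auto simp: K_def \<phi>_def intro!: generate_field.incl)
  next
    case (Var v)
    then show ?case by (auto simp: K_def B_def intro!: generate_field.incl)
  next
    case (add P Q)
    then show ?case
      using ring_hom_add[OF \<iota>_hom S_sub S_sub, of P Q]
      by (simp add: K_def generate_field.eng_add)
  next
    case (mult P Q)
    then show ?case
      using ring_hom_mult[OF \<iota>_hom S_sub S_sub, of P Q]
      by (simp add: K_def generate_field.eng_mult)
  qed
  \<comment> \<open>The generated field is closed under division, in the form in which quotients occur below.\<close>
  have quotient: "x \<in> K"
    if "a \<in> K" "b \<in> K" "b \<noteq> \<zero>\<^bsub>?L\<^esub>" "x \<in> carrier ?L" "b \<otimes>\<^bsub>?L\<^esub> x = a" for a b x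
  proof -
    have b: "b \<in> Units ?L" using that K_sub L.field_Units by auto
    have "inv\<^bsub>?L\<^esub> b \<otimes>\<^bsub>?L\<^esub> a = inv\<^bsub>?L\<^esub> b \<otimes>\<^bsub>?L\<^esub> b \<otimes>\<^bsub>?L\<^esub> x"
      unfolding that(5)[symmetric]
      by (rule L.m_assoc[symmetric, OF L.Units_inv_closed[OF b] L.Units_closed[OF b] that(4)])
    also have "\<dots> = x"
      using L.Units_l_inv[OF b] that(4) by simp
    finally have "inv\<^bsub>?L\<^esub> b \<otimes>\<^bsub>?L\<^esub> a = x" .
    moreover have "inv\<^bsub>?L\<^esub> b \<otimes>\<^bsub>?L\<^esub> a \<in> K"
      using that unfolding K_def by (intro generate_field.eng_mult generate_field.m_inv)
    ultimately show ?thesis by simp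
  qed
  have K_Var: "\<iota> (Var v) \<in> K" if v: "v \<in> V" for v
  proof -
    from gen[OF v] obtain f g where fg: "f \<in> carrier (mpoly_ring S)" "g \<in> carrier (mpoly_ring S)"
        "g \<notin> J" "g * Var v - f \<in> J"
      by blast
    note closed = S_sub[OF fg(1)] S_sub[OF fg(2)] mpoly_Var_closed[OF v]
    have "g * Var v \<ominus>\<^bsub>?R\<^esub> f \<in> J"
      using fg(4) mpoly_ring_minus[OF mpoly_mult_closed[OF closed(2,3)] closed(1)] by simp
    then have "q (g * Var v) = q f"
      using ring.quotient_eq_iff_same_a_r_cos[OF ring_mpoly_ring ideal
          mpoly_mult_closed[OF closed(2,3)] closed(1)] by (simp add: q_def)
    then have "\<iota> g \<otimes>\<^bsub>?L\<^esub> \<iota> (Var v) = \<iota> f"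
      using ring_hom_mult[OF \<iota>_hom closed(2,3)] by (simp add: \<iota>_def)
    then show ?thesis
      using quotient[OF K_S[OF fg(1)] K_S[OF fg(2)]] \<iota>_zero[OF closed(2)] \<iota>_closed[OF closed(3)]
        fg(3) by blast
  qed
  have K_V: "\<iota> P \<in> K" if "P \<in> carrier ?R" for P
    using that
  proof (induction P rule: mpoly_ring_induct_generators)
    case (Const c)
    show ?case by (rule K_S[OF mpoly_Const_closed])
  next
    case (add P Q)
    then show ?case
      using ring_hom_add[OF \<iota>_hom, of P Q] by (simp add: K_def generate_field.eng_add)
  next
    case (mult P Q)
    then show ?case
      using ring_hom_mult[OF \<iota>_hom, of P Q] by (simp add: K_def generate_field.eng_mult)
  qed (rule K_Var)
  have q_surj: "\<exists>P\<in>carrier ?R. a = q P" if "a \<in> carrier ?D" for a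
    using that by (auto simp: FactRing_def A_RCOSETS_def' q_def)
  have "carrier ?L \<subseteq> K"
  proof
    fix x assume x: "x \<in> carrier ?L"
    then obtain a b where ab: "a \<in> carrier ?D" "b \<in> carrier ?D - {\<zero>\<^bsub>?D\<^esub>}" "x = fraction ?D a b"
      by (rule D.fraction_cases)
    obtain P Q where PQ: "P \<in> carrier ?R" "a = q P" "Q \<in> carrier ?R" "b = q Q"
      using q_surj[of a] q_surj[of b] ab(1,2) by blast
    have b: "b \<in> carrier ?D" "b \<noteq> \<zero>\<^bsub>?D\<^esub>" using ab(2) by simp_all
    have "\<iota> Q \<otimes>\<^bsub>?L\<^esub> x = fraction ?D (b \<otimes>\<^bsub>?D\<^esub> a) b"
      unfolding \<iota>_def ab(3) PQ(4)[symmetric]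
      using D.fraction_mult[OF b(1) D.one_denominator ab(1,2)] b by simp
    also have "\<dots> = \<iota> P"
      unfolding \<iota>_def PQ(2)[symmetric]
      using D.fraction_eq_iff[OF D.m_closed[OF b(1) ab(1)] ab(2) ab(1) D.one_denominator] b ab(1)
      by (simp add: D.m_comm)
    finally have "\<iota> Q \<otimes>\<^bsub>?L\<^esub> x = \<iota> P" .
    moreover have "\<iota> Q \<noteq> \<zero>\<^bsub>?L\<^esub>"
      using \<iota>_zero[OF PQ(3)] q_zero[OF PQ(3)] b(2) PQ(4) by simp
    ultimately show "x \<in> K"
      using quotient[OF K_V[OF PQ(1)] K_V[OF PQ(3)]] x by blast
  qed
  then have "K = carrier ?L" using K_sub by blast
  then have "purely_transcendental \<phi> ?L"
    unfolding purely_transcendental_def K_def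
    using L.field_axioms \<phi>_hom B alg by blast
  then show ?thesis
    unfolding rational_variety_def Let_def \<phi>_def[abs_def] \<iota>_def q_def .
qed

section \<open>The ideal of blocks of rank one\<close>

text \<open>
  Graphs enter only through the partition of \<open>Y\<close> into connected components. It is recorded by
  a map \<open>r\<close> that picks a representative in each class.

  The Segre parametrization, which writes a matrix of rank at most 1 as the products of a vector
  of row parameters and a vector of column parameters, needs one row parameter for each pair of a
  row and a class, and one parameter for each column. The injection \<open>enc\<close> numbers these
  parameters: a linear order on the variables extends to an order of the monomials that is
  compatible with multiplication, and by looking at leading terms the polynomials in them form an
  integral domain.
\<close>

locale column_classes =
  fixes X0 :: "'i set" and Xin Y :: "'x set" and r :: "'x \<Rightarrow> 'x" and enc :: "'i \<times> 'x + 'x \<Rightarrow> nat"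
  assumes Y_sub: "Y \<subseteq> Xin"
    and r_closed: "x \<in> Y \<Longrightarrow> r x \<in> Y"
    and r_idem: "x \<in> Y \<Longrightarrow> r (r x) = r x"
    and enc_inj: "inj_on enc ((X0 \<times> Xin) <+> Xin)"
begin

definition generators :: "('i \<times> 'x, 'k::field) mpoly set" where
  "generators = {Var (i, x) | i x. i \<in> X0 \<and> x \<in> Xin - Y} \<union>
      {Var (i, x) * Var (j, y) - Var (i, y) * Var (j, x) | i j x y.
         i \<in> X0 \<and> j \<in> X0 \<and> x \<in> Y \<and> y \<in> Y \<and> r x = r y}"

definition minors_ideal :: "('i \<times> 'x, 'k::field) mpoly set" where
  "minors_ideal = Idl\<^bsub>mpoly_ring (X0 \<times> Xin)\<^esub> generators"

text \<open>
  The entry in row \<open>i\<close> and column \<open>x\<close> becomes the product of the parameter of row \<open>i\<close> in the class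
  of \<open>x\<close> and the parameter of column \<open>x\<close>. Hence the image of a monomial in the entries records its
  row sums within each class and its column sums.
\<close>

definition segre_exponent :: "'i \<times> 'x \<Rightarrow> (nat \<Rightarrow>\<^sub>0 nat)" where
  "segre_exponent v = Poly_Mapping.single (enc (Inl (fst v, r (snd v)))) 1
     + Poly_Mapping.single (enc (Inr (snd v))) 1"

abbreviation segre :: "('i \<times> 'x, 'k::field) mpoly \<Rightarrow> (nat, 'k) mpoly" where
  "segre \<equiv> monomial_subst (X0 \<times> Y) segre_exponent"

lemma segre_exponent_row:
  assumes "i \<in> X0" "x \<in> Y" "j \<in> X0" "s \<in> Y"
  shows "0 < Poly_Mapping.lookup (segre_exponent (i, x)) (enc (Inl (j, s))) \<longleftrightarrow> i = j \<and> r x = s"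
proof -
  have mem: "Inl (i, r x) \<in> (X0 \<times> Xin) <+> Xin" "Inl (j, s) \<in> (X0 \<times> Xin) <+> Xin"
      "Inr x \<in> (X0 \<times> Xin) <+> Xin"
    using assms r_closed[of x] Y_sub by auto
  then have "enc (Inl (i, r x)) = enc (Inl (j, s)) \<longleftrightarrow> i = j \<and> r x = s"
      "enc (Inr x) \<noteq> enc (Inl (j, s))"
    by (simp_all add: inj_on_eq_iff[OF enc_inj])
  then show ?thesis
    by (simp add: segre_exponent_def lookup_add lookup_single when_def)
qed

lemma segre_exponent_column:
  assumes "i \<in> X0" "x \<in> Y" "y \<in> Y"
  shows "0 < Poly_Mapping.lookup (segre_exponent (i, x)) (enc (Inr y)) \<longleftrightarrow> x = y"
proof -
  have mem: "Inl (i, r x) \<in> (X0 \<times> Xin) <+> Xin" "Inr y \<in> (X0 \<times> Xin) <+> Xin"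
      "Inr x \<in> (X0 \<times> Xin) <+> Xin"
    using assms r_closed[of x] Y_sub by auto
  then have "enc (Inr x) = enc (Inr y) \<longleftrightarrow> x = y" "enc (Inl (i, r x)) \<noteq> enc (Inr y)"
    by (simp_all add: inj_on_eq_iff[OF enc_inj])
  then show ?thesis
    by (simp add: segre_exponent_def lookup_add lookup_single when_def)
qed

text \<open>
  Exchanging the columns of two entries in the same class preserves row and column sums; this is
  the monomial form of a vanishing minor.
\<close>

lemma segre_exponent_swap:
  "r x = r y \<Longrightarrow>
    segre_exponent (i, x) + segre_exponent (j, y) = segre_exponent (i, y) + segre_exponent (j, x)"
  by (simp add: segre_exponent_def ac_simps)

lemma generators_closed: "generators \<subseteq> carrier (mpoly_ring (X0 \<times> Xin))"
  using Y_sub by (fastforce simp: generators_def intro!: mpoly_closed)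

lemma minors_ideal: "ideal minors_ideal (mpoly_ring (X0 \<times> Xin))"
  unfolding minors_ideal_def by (rule ring.genideal_ideal[OF ring_mpoly_ring generators_closed])

lemma generators_sub: "generators \<subseteq> minors_ideal"
  unfolding minors_ideal_def by (rule ring.genideal_self[OF ring_mpoly_ring generators_closed])

lemma Var_in_minors_ideal: "i \<in> X0 \<Longrightarrow> x \<in> Xin - Y \<Longrightarrow> Var (i, x) \<in> minors_ideal"
  using generators_sub by (auto simp: generators_def)

lemma minor_in_minors_ideal:
  "i \<in> X0 \<Longrightarrow> j \<in> X0 \<Longrightarrow> x \<in> Y \<Longrightarrow> y \<in> Y \<Longrightarrow> r x = r y \<Longrightarrow>
    Var (i, x) * Var (j, y) - Var (i, y) * Var (j, x) \<in> minors_ideal"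
  using generators_sub unfolding generators_def by blast

text \<open>
  Two nonnegative integer matrices with the same row sums in each class and the same column sums
  are connected by moves along 2-by-2 minors. Induct on the first monomial, and let \<open>(i, x)\<close> be an
  entry of it. Comparing sums, the second monomial has an entry in row \<open>i\<close> in the class of \<open>x\<close>,
  say \<open>(i, y)\<close>, and an entry \<open>(j, x)\<close> in column \<open>x\<close>. One minor trades these two for \<open>(i, x)\<close> and
  \<open>(j, y)\<close>, after which \<open>(i, x)\<close> is a common factor.
\<close>

lemma binomial_in_minors_ideal:
  assumes "Poly_Mapping.keys m \<subseteq> X0 \<times> Y" "Poly_Mapping.keys m' \<subseteq> X0 \<times> Y"
    and "exponent_subst segre_exponent m = exponent_subst segre_exponent m'"
  shows "Poly_Mapping.single m 1 - Poly_Mapping.single m' 1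
    \<in> (minors_ideal :: ('i \<times> 'x, 'k::field) mpoly set)"
  using assms
proof (induction m arbitrary: m' rule: monomial_induct)
  case zero
  have "m' = 0"
  proof (rule ccontr)
    assume "m' \<noteq> 0"
    then obtain v where "v \<in> Poly_Mapping.keys m'"
      using keys_eq_empty[of m'] by blast
    then obtain i x where v: "(i, x) \<in> Poly_Mapping.keys m'"
      by (cases v) simp
    then have "0 < Poly_Mapping.lookup (exponent_subst segre_exponent m') (enc (Inr x))"
      unfolding exponent_subst_pos_iff using zero(1) segre_exponent_column[of i x x] by blast
    then show False using zero(2) by simp
  qed
  then show ?case using ideal_zero[OF minors_ideal] by simp
next
  case (add_single n v)
  obtain i x where v: "v = (i, x)" "i \<in> X0" "x \<in> Y" using add_single(2) by auto
  let ?E = "exponent_subst segre_exponent"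
  have E: "?E m' = segre_exponent (i, x) + ?E n"
    using add_single.prems(2) by (simp add: exponent_subst_add exponent_subst_single[simplified] v)
  \<comment> \<open>Once both monomials contain the variable, it can be divided out.\<close>
  have common: "Poly_Mapping.single (Poly_Mapping.single v 1 + n) 1
      - Poly_Mapping.single (Poly_Mapping.single v 1 + n') 1
      \<in> (minors_ideal :: ('i \<times> 'x, 'k) mpoly set)"
    if n': "Poly_Mapping.keys n' \<subseteq> X0 \<times> Y" "?E n = ?E n'" for n'
  proof -
    have "Var v * (Poly_Mapping.single n 1 - Poly_Mapping.single n' 1)
        \<in> (minors_ideal :: ('i \<times> 'x, 'k) mpoly set)"
      using add_single.IH[OF n'] v Y_sub
      by (intro ideal_mult_left[OF minors_ideal] mpoly_Var_closed) auto
    then show ?thesis by (simp only: right_diff_distrib Var_mult_single)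
  qed
  have "0 < Poly_Mapping.lookup (?E m') (enc (Inl (i, r x)))"
    using segre_exponent_row[of i x i "r x"] v r_closed by (simp add: E lookup_add)
  then obtain y where y: "(i, y) \<in> Poly_Mapping.keys m'" "y \<in> Y" "r y = r x"
    unfolding exponent_subst_pos_iff
    using add_single.prems(1) segre_exponent_row[of _ _ i "r x"] v r_closed by fastforce
  have "0 < Poly_Mapping.lookup (?E m') (enc (Inr x))"
    using segre_exponent_column[of i x x] v by (simp add: E lookup_add)
  then obtain j where j: "(j, x) \<in> Poly_Mapping.keys m'" "j \<in> X0"
    unfolding exponent_subst_pos_iff
    using add_single.prems(1) segre_exponent_column[of _ _ x] v by fastforce
  obtain p where p: "m' = Poly_Mapping.single (i, y) 1 + p"
      "Poly_Mapping.keys p \<subseteq> Poly_Mapping.keys m'"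
    using monomial_extract[OF y(1)] .
  \<comment> \<open>If both entries coincide, the second monomial contains \<open>(i, x)\<close> already.\<close>
  show ?case
  proof (cases "(j, x) = (i, y)")
    case True
    have "?E n = ?E p"
      using E True by (simp add: p(1) exponent_subst_add exponent_subst_single[simplified])
    then show ?thesis
      using common[of p] p add_single.prems(1) v True by auto
  next
    case False
    then have "(j, x) \<in> Poly_Mapping.keys p"
      using j(1) unfolding p(1) keys_single_add by blast
    then obtain q where q: "p = Poly_Mapping.single (j, x) 1 + q"
        "Poly_Mapping.keys q \<subseteq> Poly_Mapping.keys p"
      by (rule monomial_extract)
    let ?n' = "Poly_Mapping.single (j, y) 1 + q"
    have keys: "Poly_Mapping.keys q \<subseteq> X0 \<times> Y"
      using p(2) q(2) add_single.prems(1) by blast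
    have "segre_exponent (i, x) + ?E n = segre_exponent (i, x) + ?E ?n'"
      using E segre_exponent_swap[of y x i j] y(3)
      by (simp add: p(1) q(1) exponent_subst_add exponent_subst_single[simplified] ac_simps)
    then have shared: "Poly_Mapping.single (Poly_Mapping.single v 1 + n) 1
        - Poly_Mapping.single (Poly_Mapping.single v 1 + ?n') 1
        \<in> (minors_ideal :: ('i \<times> 'x, 'k) mpoly set)"
      using keys j y by (intro common) (auto simp only: keys_single_add add_left_cancel)
    have swap: "(Var (i, x) * Var (j, y) - Var (i, y) * Var (j, x)) * Poly_Mapping.single q 1
        \<in> (minors_ideal :: ('i \<times> 'x, 'k) mpoly set)"
      using v j y keys Y_sub
      by (intro ideal_mult[OF minors_ideal] minor_in_minors_ideal mpoly_single_closed) auto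
    have "(Var (i, x) * Var (j, y) - Var (i, y) * Var (j, x)) * Poly_Mapping.single q (1::'k)
        = Poly_Mapping.single (Poly_Mapping.single v 1 + ?n') 1 - Poly_Mapping.single m' 1"
      by (simp only: v p(1) q(1) left_diff_distrib mult.assoc Var_mult_single)
    then show ?thesis
      using ideal_add[OF minors_ideal shared swap] by simp
  qed
qed

text \<open>
  The Segre map kills each generator. Conversely, its kernel is spanned by monomials with a factor
  outside \<open>Y\<close> and by binomials with equal row and column sums, which all lie in the ideal.
\<close>

lemma minors_ideal_eq_kernel:
  "(minors_ideal :: ('i \<times> 'x, 'k::field) mpoly set)
    = {P \<in> carrier (mpoly_ring (X0 \<times> Xin)). segre P = 0}"
proof
  have "ideal {P \<in> carrier (mpoly_ring (X0 \<times> Xin)). segre P = (0 :: (nat, 'k) mpoly)}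
      (mpoly_ring (X0 \<times> Xin))"
    using a_kernel_ideal[OF ring_mpoly_ring ring_from_type_algebra monomial_subst_hom] by simp
  moreover have "segre P = 0" if "P \<in> generators" for P :: "('i \<times> 'x, 'k) mpoly"
    using that unfolding generators_def
    by (auto simp: monomial_subst_diff monomial_subst_mult monomial_subst_Var mult_single
        segre_exponent_swap)
  ultimately show "(minors_ideal :: ('i \<times> 'x, 'k) mpoly set)
      \<subseteq> {P \<in> carrier (mpoly_ring (X0 \<times> Xin)). segre P = 0}"
    unfolding minors_ideal_def using generators_closed
    by (intro ring.genideal_minimal[OF ring_mpoly_ring]) blast+
next
  have VW: "(X0 \<times> Xin) \<inter> (X0 \<times> Y) = X0 \<times> Y" using Y_sub by blast
  show "{P \<in> carrier (mpoly_ring (X0 \<times> Xin)). segre P = 0}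
      \<subseteq> (minors_ideal :: ('i \<times> 'x, 'k) mpoly set)"
  proof safe
    fix P :: "('i \<times> 'x, 'k) mpoly"
    assume "P \<in> carrier (mpoly_ring (X0 \<times> Xin))" "segre P = 0"
    then show "P \<in> minors_ideal"
    proof (rule kernel_monomial_subst_subset[OF minors_ideal, rotated 2])
      fix v assume "v \<in> X0 \<times> Xin - X0 \<times> Y"
      then show "Var v \<in> (minors_ideal :: ('i \<times> 'x, 'k) mpoly set)"
        using Var_in_minors_ideal by auto
    qed (rule binomial_in_minors_ideal, simp_all only: VW)
  qed
qed

lemma primeideal_minors_ideal:
  "primeideal (minors_ideal :: ('i \<times> 'x, 'k::field) mpoly set) (mpoly_ring (X0 \<times> Xin))"
  unfolding minors_ideal_eq_kernel by (rule primeideal_kernel[OF cring_mpoly_ring monomial_subst_hom])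

text \<open>
  The coordinates in row \<open>i0\<close>, together with the full columns of the class representatives. As long
  as the entries in row \<open>i0\<close> at the representatives are nonzero, these coordinates can be prescribed
  freely and determine all columns in \<open>Y\<close> of a matrix whose blocks have rank at most 1.
\<close>

definition cross :: "'i \<Rightarrow> ('i \<times> 'x) set" where
  "cross i0 = {(i, x). i \<in> X0 \<and> x \<in> Y \<and> (i = i0 \<or> r x = x)}"

text \<open>
  A monomial supported on the cross is determined by its row and column sums. Off the pivots
  \<open>(i0, r x)\<close> an entry is the only one of the cross in its row of the class or in its column. The
  pivot is then what remains of the sum over row \<open>i0\<close> of its class.
\<close>

lemma inj_on_segre_cross:
  "inj_on (exponent_subst segre_exponent) {m. Poly_Mapping.keys m \<subseteq> cross i0}"
proof (rule inj_onI)
  fix m m' :: "'i \<times> 'x \<Rightarrow>\<^sub>0 nat"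
  assume "m \<in> {m. Poly_Mapping.keys m \<subseteq> cross i0}" "m' \<in> {m. Poly_Mapping.keys m \<subseteq> cross i0}"
    and eq: "exponent_subst segre_exponent m = exponent_subst segre_exponent m'"
  then have sub: "Poly_Mapping.keys m \<subseteq> cross i0" "Poly_Mapping.keys m' \<subseteq> cross i0" by simp_all
  define K where "K = Poly_Mapping.keys m \<union> Poly_Mapping.keys m'"
  have K: "finite K" "Poly_Mapping.keys m \<subseteq> K" "Poly_Mapping.keys m' \<subseteq> K" by (auto simp: K_def)
  have KD: "i \<in> X0" "x \<in> Y" "i = i0 \<or> r x = x" if "(i, x) \<in> K" for i x
    using that sub by (auto simp: K_def cross_def)
  note cancel = exponent_subst_cancel[OF K _ eq]
  have off: "Poly_Mapping.lookup m (i, x) = Poly_Mapping.lookup m' (i, x)"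
    if v: "(i, x) \<in> K" and off: "i \<noteq> i0 \<or> r x \<noteq> x" for i x
  proof (cases "i = i0")
    case False
    show ?thesis
    proof (rule cancel[OF v, where w = "enc (Inl (i, x))"])
      show "0 < Poly_Mapping.lookup (segre_exponent (i, x)) (enc (Inl (i, x)))"
        using segre_exponent_row[of i x i x] KD[OF v] False by simp
      fix u assume u: "u \<in> K" "u \<noteq> (i, x)"
        "0 < Poly_Mapping.lookup (segre_exponent u) (enc (Inl (i, x)))"
      obtain j y where "u = (j, y)" by fastforce
      then show "Poly_Mapping.lookup m u = Poly_Mapping.lookup m' u"
        using segre_exponent_row[of j y i x] KD[of j y] KD[OF v] u False by auto
    qed
  next
    case True
    show ?thesis
    proof (rule cancel[OF v, where w = "enc (Inr x)"])
      show "0 < Poly_Mapping.lookup (segre_exponent (i, x)) (enc (Inr x))"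
        using segre_exponent_column[of i x x] KD[OF v] by simp
      fix u assume u: "u \<in> K" "u \<noteq> (i, x)"
        "0 < Poly_Mapping.lookup (segre_exponent u) (enc (Inr x))"
      obtain j y where "u = (j, y)" by fastforce
      then show "Poly_Mapping.lookup m u = Poly_Mapping.lookup m' u"
        using segre_exponent_column[of j y x] KD[of j y] KD[OF v] u True off by auto
    qed
  qed
  \<comment> \<open>All other contributions to this row sum have just been matched.\<close>
  have on: "Poly_Mapping.lookup m (i0, x) = Poly_Mapping.lookup m' (i0, x)"
    if v: "(i0, x) \<in> K" and rx: "r x = x" for x
  proof (rule cancel[OF v, where w = "enc (Inl (i0, x))"])
    show "0 < Poly_Mapping.lookup (segre_exponent (i0, x)) (enc (Inl (i0, x)))"
      using segre_exponent_row[of i0 x i0 x] KD[OF v] rx by simp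
    fix u assume u: "u \<in> K" "u \<noteq> (i0, x)"
      "0 < Poly_Mapping.lookup (segre_exponent u) (enc (Inl (i0, x)))"
    obtain j y where jy: "u = (j, y)" by fastforce
    then have "j = i0" "r y = x"
      using segre_exponent_row[of j y i0 x] KD[of j y] KD[OF v] u by auto
    then show "Poly_Mapping.lookup m u = Poly_Mapping.lookup m' u"
      using off[of j y] u jy by auto
  qed
  show "m = m'"
  proof (rule poly_mapping_eqI)
    fix u :: "'i \<times> 'x"
    obtain i x where u: "u = (i, x)" by fastforce
    show "Poly_Mapping.lookup m u = Poly_Mapping.lookup m' u"
    proof (cases "u \<in> K")
      case True
      then show ?thesis using off[of i x] on[of x] u by blast
    next
      case False
      then show ?thesis using K(2,3) by (simp add: K_def in_keys_iff)
    qed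
  qed
qed

text \<open>
  The minor on rows \<open>i0\<close>, \<open>i\<close> and columns \<open>r x\<close>, \<open>x\<close> expresses the coordinate \<open>(i, x)\<close> as a quotient
  of coordinates on the cross, with denominator \<open>(i0, r x)\<close>. Independence on the cross holds
  because the Segre map is injective there.
\<close>

lemma rational_minors_ideal:
  assumes i0: "i0 \<in> X0"
  shows "rational_variety (X0 \<times> Xin) (minors_ideal :: ('i \<times> 'x, 'k::field) mpoly set)"
proof (rule rational_varietyI[OF primeideal_minors_ideal, of "cross i0"])
  show "cross i0 \<subseteq> X0 \<times> Xin"
    using Y_sub by (auto simp: cross_def)
  show "P = 0" if "P \<in> carrier (mpoly_ring (cross i0))" "P \<in> minors_ideal"
    for P :: "('i \<times> 'x, 'k) mpoly"
    by (rule monomial_subst_injective[OF inj_on_segre_cross, of i0 "X0 \<times> Y"])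
      (use that in \<open>auto simp: cross_def minors_ideal_eq_kernel\<close>)
  fix v assume "v \<in> X0 \<times> Xin"
  then obtain i x where v: "v = (i, x)" "i \<in> X0" "x \<in> Xin" by blast
  show "\<exists>f\<in>carrier (mpoly_ring (cross i0)). \<exists>g\<in>carrier (mpoly_ring (cross i0)).
      g \<notin> minors_ideal \<and> g * Var v - f \<in> (minors_ideal :: ('i \<times> 'x, 'k) mpoly set)"
  proof (cases "x \<in> Y")
    case False
    have "segre (1 :: ('i \<times> 'x, 'k) mpoly) \<noteq> 0"
      using monomial_subst_Const[of "X0 \<times> Y" segre_exponent "1 :: 'k"] by (simp add: Const_one)
    then have "1 \<notin> (minors_ideal :: ('i \<times> 'x, 'k) mpoly set)"
      by (simp add: minors_ideal_eq_kernel)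
    moreover have "1 * Var v - 0 \<in> (minors_ideal :: ('i \<times> 'x, 'k) mpoly set)"
      using Var_in_minors_ideal[of i x] v False by simp
    ultimately show ?thesis
      using mpoly_zero_closed mpoly_one_closed by blast
  next
    case True
    have "segre (Var (i0, r x) :: ('i \<times> 'x, 'k) mpoly) \<noteq> 0"
      using i0 r_closed[OF True] by (simp add: monomial_subst_Var flip: keys_eq_empty)
    then have "Var (i0, r x) \<notin> (minors_ideal :: ('i \<times> 'x, 'k) mpoly set)"
      by (simp add: minors_ideal_eq_kernel)
    moreover have "Var (i0, r x) * Var v - Var (i0, x) * Var (i, r x)
        \<in> (minors_ideal :: ('i \<times> 'x, 'k) mpoly set)"
      unfolding v(1) using i0 v True r_closed r_idem by (intro minor_in_minors_ideal) auto
    moreover have "(i0, r x) \<in> cross i0" "(i0, x) \<in> cross i0" "(i, r x) \<in> cross i0"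
      using i0 v True r_closed r_idem by (auto simp: cross_def)
    ultimately show ?thesis
      by (meson mpoly_Var_closed mpoly_mult_closed)
  qed
qed

end

section \<open>Proportional columns and connected components\<close>

text \<open>
  A nonzero coordinate of \<open>v\<close> provides the factor; if \<open>v\<close> vanishes, the factor 0 works.
\<close>

lemma proportional_iff_minors:
  "proportional S v w \<longleftrightarrow> (\<forall>i\<in>S. \<forall>j\<in>S. v i * w j - w i * v j = 0)"
proof
  assume "proportional S v w"
  then show "\<forall>i\<in>S. \<forall>j\<in>S. v i * w j - w i * v j = 0"
    by (auto simp: proportional_def)
next
  assume minors: "\<forall>i\<in>S. \<forall>j\<in>S. v i * w j - w i * v j = 0"
  show "proportional S v w"
  proof (cases "\<forall>i\<in>S. v i = 0")
    case True
    then show ?thesis unfolding proportional_def by (intro exI[of _ 0]) simp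
  next
    case False
    then obtain k where k: "k \<in> S" "v k \<noteq> 0" by blast
    have "w i = w k / v k * v i" if "i \<in> S" for i
      using minors k that by (simp add: field_simps)
    then show ?thesis unfolding proportional_def by blast
  qed
qed

lemma same_component_refl:
  assumes "wf_digraph H" "x \<in> verts H"
  shows "same_component H x x"
  using wf_digraph.scc_of_in_sccs_verts[OF assms] wf_digraph.in_scc_of_self[OF assms]
  by (auto simp: same_component_def)

lemma same_component_sym: "same_component H x y \<Longrightarrow> same_component H y x"
  unfolding same_component_def by blast

lemma same_component_trans:
  assumes H: "wf_digraph H" and "same_component H x y" "same_component H y z"
  shows "same_component H x z"
proof -
  obtain C D where CD: "C \<in> pre_digraph.sccs_verts H" "D \<in> pre_digraph.sccs_verts H"
      "x \<in> C" "y \<in> C" "y \<in> D" "z \<in> D"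
    using assms(2,3) by (auto simp: same_component_def)
  then have "C = D" using wf_digraph.sccs_verts_disjoint[OF H CD(1,2)] by blast
  then show ?thesis using CD by (auto simp: same_component_def)
qed

text \<open>
  Lying in the same component is an equivalence relation on \<open>Y\<close>. Choosing from the whole class
  makes the choice depend on the class only.
\<close>

lemma component_representative:
  assumes "wf_digraph G"
  obtains r where "\<And>x. x \<in> Y \<Longrightarrow> r x \<in> Y" "\<And>x. x \<in> Y \<Longrightarrow> r (r x) = r x"
    "\<And>x y. x \<in> Y \<Longrightarrow> y \<in> Y \<Longrightarrow> same_component (G \<restriction> Y) x y \<longleftrightarrow> r x = r y"
proof -
  let ?H = "G \<restriction> Y"
  have wf: "wf_digraph ?H" by (rule wf_digraph.wellformed_induce_subgraph[OF assms])
  define r where "r x = (SOME z. z \<in> Y \<and> same_component ?H x z)" for x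
  have r: "r x \<in> Y \<and> same_component ?H x (r x)" if "x \<in> Y" for x
    unfolding r_def by (rule someI[of _ x]) (use that same_component_refl[OF wf, of x] in simp)
  have eq: "same_component ?H x y \<longleftrightarrow> r x = r y" if "x \<in> Y" "y \<in> Y" for x y
  proof
    assume xy: "same_component ?H x y"
    have "same_component ?H x z \<longleftrightarrow> same_component ?H y z" for z
      using xy same_component_sym same_component_trans[OF wf] by metis
    then show "r x = r y" by (simp add: r_def)
  next
    assume "r x = r y"
    then show "same_component ?H x y"
      using r that same_component_sym same_component_trans[OF wf] by metis
  qed
  show ?thesis
  proof (rule that[of r])
    show "r (r x) = r x" if "x \<in> Y" for x
      using r[OF that] eq[of x "r x"] that by simp
  qed (use r eq in blast)+
qed

theorem lemma5:
  fixes X0 :: "'i set" and Xin Y :: "'x set" and G :: "('x, 'e) pre_digraph"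
  assumes "finite X0" and "finite Xin" and "card X0 > 1"
    and "graph G" and "verts G = Xin"
    and "Y \<subseteq> Xin"
  shows "(graph_variety X0 Xin G Y :: ('i \<times> 'x \<Rightarrow> 'k::field) set)
           = zero_set (X0 \<times> Xin) (graph_ideal X0 Xin G Y) \<and>
         primeideal (graph_ideal X0 Xin G Y :: ('i \<times> 'x, 'k) mpoly set) (mpoly_ring (X0 \<times> Xin)) \<and>
         rational_variety (X0 \<times> Xin) (graph_ideal X0 Xin G Y :: ('i \<times> 'x, 'k) mpoly set)"
proof -
  have "wf_digraph G"
    using \<open>graph G\<close> by (simp add: graph_def digraph_def fin_digraph_def)
  then obtain r where r: "\<And>x. x \<in> Y \<Longrightarrow> r x \<in> Y" "\<And>x. x \<in> Y \<Longrightarrow> r (r x) = r x"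
    and same: "\<And>x y. x \<in> Y \<Longrightarrow> y \<in> Y \<Longrightarrow> same_component (G \<restriction> Y) x y \<longleftrightarrow> r x = r y"
    by (rule component_representative[where Y = Y]) blast
  have "finite ((X0 \<times> Xin) <+> Xin)" using assms(1,2) by simp
  then obtain enc :: "'i \<times> 'x + 'x \<Rightarrow> nat" where "inj_on enc ((X0 \<times> Xin) <+> Xin)"
    by (blast dest: finite_imp_inj_to_nat_seg)
  then interpret column_classes X0 Xin Y r enc
    by unfold_locales (use r assms in blast)+
  have ideal: "graph_ideal X0 Xin G Y = (minors_ideal :: ('i \<times> 'x, 'k) mpoly set)"
  proof -
    have "{Var (i, x) * Var (j, y) - Var (i, y) * Var (j, x) | i j x y.
         i \<in> X0 \<and> j \<in> X0 \<and> x \<in> Y \<and> y \<in> Y \<and> same_component (G \<restriction> Y) x y}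
      = {Var (i, x) * Var (j, y) - Var (i, y) * Var (j, x) :: ('i \<times> 'x, 'k) mpoly | i j x y.
         i \<in> X0 \<and> j \<in> X0 \<and> x \<in> Y \<and> y \<in> Y \<and> r x = r y}"
      using same by blast
    then show ?thesis
      unfolding graph_ideal_def minors_ideal_def generators_def by simp
  qed
  have "(\<forall>P\<in>generators. mpoly_eval ring_of_type_algebra id p P = 0) \<longleftrightarrow>
      (\<forall>x \<in> Xin - Y. \<forall>i \<in> X0. column p x i = 0) \<and>
      (\<forall>x \<in> Y. \<forall>y \<in> Y. same_component (G \<restriction> Y) x y \<longrightarrow>
         proportional X0 (column p x) (column p y))" (is "?zero = ?variety")
    for p :: "'i \<times> 'x \<Rightarrow> 'k"
  proof
    assume zero: ?zero
    have "column p x i = 0" if "x \<in> Xin - Y" "i \<in> X0" for x i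
    proof -
      have "Var (i, x) \<in> (generators :: ('i \<times> 'x, 'k) mpoly set)"
        using that unfolding generators_def by blast
      then have "mpoly_eval ring_of_type_algebra id p (Var (i, x)) = 0"
        using zero by blast
      then show ?thesis by (simp add: eval_at_point_Var column_def)
    qed
    moreover have "column p x i * column p y j - column p y i * column p x j = 0"
      if "x \<in> Y" "y \<in> Y" "r x = r y" "i \<in> X0" "j \<in> X0" for x y i j
    proof -
      have "Var (i, x) * Var (j, y) - Var (i, y) * Var (j, x) \<in> (generators :: ('i \<times> 'x, 'k) mpoly set)"
        using that unfolding generators_def by blast
      then have "mpoly_eval ring_of_type_algebra id p
          (Var (i, x) * Var (j, y) - Var (i, y) * Var (j, x)) = 0"
        using zero by blast
      then show ?thesis by (simp only: eval_at_point_minor)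
    qed
    ultimately show ?variety
      by (simp add: proportional_iff_minors same)
  next
    assume variety: ?variety
    show ?zero
    proof
      fix P :: "('i \<times> 'x, 'k) mpoly"
      assume "P \<in> generators"
      then consider i x where "P = Var (i, x)" "i \<in> X0" "x \<in> Xin - Y"
        | i j x y where "P = Var (i, x) * Var (j, y) - Var (i, y) * Var (j, x)"
            "i \<in> X0" "j \<in> X0" "x \<in> Y" "y \<in> Y" "r x = r y"
        unfolding generators_def by blast
      then show "mpoly_eval ring_of_type_algebra id p P = 0"
      proof cases
        case 1
        then show ?thesis using variety by (simp add: eval_at_point_Var column_def)
      next
        case 2
        then have "proportional X0 (column p x) (column p y)"
          using variety same by blast
        then show ?thesis
          using 2(2,3) unfolding 2(1) eval_at_point_minor proportional_iff_minors by blast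
      qed
    qed
  qed
  then have "graph_variety X0 Xin G Y = zero_set (X0 \<times> Xin) (minors_ideal :: ('i \<times> 'x, 'k) mpoly set)"
    unfolding graph_variety_def minors_ideal_def zero_set_genideal[OF generators_closed] by simp
  moreover obtain i0 where "i0 \<in> X0"
    using \<open>card X0 > 1\<close> by fastforce
  ultimately show ?thesis
    unfolding ideal using primeideal_minors_ideal rational_minors_ideal by blast
qed

end
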